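(* Let $f, g_1,\ldots,g_m$ be convex polynomials on $\mathbb{R}^n$ with $K := \{x\in\mathbb{R}^n \mid g_1(x)\le 0,\ldots,g_m(x)\le 0\}\neq\emptyset$, and consider the problem $f^* := \min_{x\in K} f(x)$. Let $x^*$ be a minimizer of this problem, i.e. $x^*\in K$ and $f(x^* )=f^*$. Let $c\in\mathbb{R}$ be such that $c>f(x^0)$ for some $x^0\in K$, and for each integer $k$ let $f_k^* := \sup\{\mu\in\mathbb{R} \mid f-\mu\in\mathbf{M}_k\}$, where $\mathbf{M}_k$ is the truncated quadratic module generated by $c-f,-g_1,\ldots,-g_m$. Then $\lim_{k\to\infty} f_k^* = f^*$.
   Context: $\mathbb{R}[\underline{x}]$ is the ring of real polynomials in $x=(x_1,\ldots,x_n)$. $\Sigma^2\subset\mathbb{R}[\underline{x}]$ is the set of sum-of-squares polynomials, i.e. those of the form $\sum_{j=1}^r f_j^2$ with $f_j\in\mathbb{R}[\underline{x}]$. For each integer $k$, the truncated quadratic module is $$\mathbf{M}_k := \Big\{\sigma_0-\sum_{i=1}^m\sigma_i g_i+\sigma(c-f) \ \Big|\ \sigma,\sigma_0,\sigma_1,\ldots,\sigma_m\in\Sigma^2,\ \deg\sigma_0\le 2k,\ \deg(\sigma_i g_i)\le 2k\ (i=1,\ldots,m),\ \deg(\sigma(c-f))\le 2k\Big\}.$$ The supremum of the empty set is $-\infty$, and the zero polynomial satisfies every degree bound. *)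

theory Defs
  imports "HOL-Analysis.Analysis" "HOL-Library.Poly_Mapping"
begin

text \<open>
  Real polynomials in variables indexed by a finite type \<open>'n\<close>: finitely supported
  families of coefficients, indexed by the finitely supported families of exponents.
  The commutative ring structure is the convolution ring of \<^theory>\<open>HOL-Library.Poly_Mapping\<close>.
\<close>
type_synonym 'n mpoly = "('n \<Rightarrow>\<^sub>0 nat) \<Rightarrow>\<^sub>0 real"

definition mp_const :: "real \<Rightarrow> 'n::finite mpoly" where
  "mp_const a = Poly_Mapping.single 0 a"

definition mp_eval :: "'n::finite mpoly \<Rightarrow> real ^ 'n \<Rightarrow> real" where
  "mp_eval p x = (\<Sum>a\<in>Poly_Mapping.keys p. Poly_Mapping.lookup p a *
     (\<Prod>i\<in>UNIV. (x $ i) ^ Poly_Mapping.lookup a i))"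

text \<open>Total degree. It is \<open>0\<close> at the zero polynomial; \<open>deg_le\<close> treats that case separately.\<close>
definition mp_degree :: "'n::finite mpoly \<Rightarrow> nat" where
  "mp_degree p = Max (insert 0 ((\<lambda>a. \<Sum>i\<in>UNIV. Poly_Mapping.lookup a i) ` Poly_Mapping.keys p))"

text \<open>The zero polynomial satisfies every degree bound, including negative ones.\<close>
definition deg_le :: "'n::finite mpoly \<Rightarrow> int \<Rightarrow> bool" where
  "deg_le p d \<longleftrightarrow> p = 0 \<or> int (mp_degree p) \<le> d"

definition SOS :: "'n::finite mpoly set" where
  "SOS = {p. \<exists>(r::nat) h. p = (\<Sum>j=1..r. (h j)\<^sup>2)}"

definition feasible_set :: "nat \<Rightarrow> (nat \<Rightarrow> 'n::finite mpoly) \<Rightarrow> (real ^ 'n) set" where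
  "feasible_set m g = {x. \<forall>i\<in>{1..m}. mp_eval (g i) x \<le> 0}"

definition trunc_qmodule ::
  "real \<Rightarrow> 'n::finite mpoly \<Rightarrow> nat \<Rightarrow> (nat \<Rightarrow> 'n mpoly) \<Rightarrow> int \<Rightarrow> 'n mpoly set" where
  "trunc_qmodule c f m g k =
     {\<sigma>\<^sub>0 - (\<Sum>i=1..m. \<sigma>s i * g i) + \<sigma> * (mp_const c - f) | \<sigma> \<sigma>\<^sub>0 \<sigma>s.
        \<sigma> \<in> SOS \<and> \<sigma>\<^sub>0 \<in> SOS \<and> (\<forall>i\<in>{1..m}. \<sigma>s i \<in> SOS) \<and>
        deg_le \<sigma>\<^sub>0 (2 * k) \<and>
        (\<forall>i\<in>{1..m}. deg_le (\<sigma>s i * g i) (2 * k)) \<and>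
        deg_le (\<sigma> * (mp_const c - f)) (2 * k)}"

text \<open>The supremum is taken in the extended reals, so that it is \<open>-\<infinity>\<close> on the empty set.\<close>
definition sos_bound ::
  "real \<Rightarrow> 'n::finite mpoly \<Rightarrow> nat \<Rightarrow> (nat \<Rightarrow> 'n mpoly) \<Rightarrow> int \<Rightarrow> ereal" where
  "sos_bound c f m g k = Sup (ereal ` {\<mu>. f - mp_const \<mu> \<in> trunc_qmodule c f m g k})"

end

theory Submission
  imports Defs
begin

text \<open>
  Since \<open>c - f\<close> and all \<open>- g i\<close> are nonnegative at the minimizer, no relaxation exceeds \<open>fs\<close>. For the
  lower bound it suffices to write \<open>f - (fs - \<epsilon>)\<close>, for every \<open>\<epsilon> > 0\<close>, as an element of the quadratic
  module; the degrees in such a certificate are finite. The feasible set need not be compact and no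
  constraint qualification is assumed, and both are replaced by convexity.

  Duality. A system of convex polynomial inequalities that is solvable up to every tolerance is
  solvable (\<open>convex_system_exact\<close>), because a convex polynomial that is bounded on one ray is constant
  along its direction. With the separation theorem this yields multipliers \<open>l i \<ge> 0\<close> for which the
  Lagrangian \<open>L = f + (\<Sum>i. l i * g i)\<close> is at least \<open>fs - \<epsilon> / 2\<close> on the whole space
  (\<open>convex_polynomial_zero_duality_gap\<close>). A representation \<open>L - (fs - \<epsilon>) = \<sigma>0 + \<sigma> * (c - L)\<close> with
  sums of squares gives the required certificate for \<open>f\<close>, because
  \<open>\<sigma> * (c - L) = \<sigma> * (c - f) - (\<Sum>i. \<sigma> * l i * g i)\<close>.

  The representation of \<open>L\<close> (\<open>bounded_below_convex_certificate\<close>). After adding squares of linear forms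
  in the directions along which \<open>L\<close> is constant, \<open>L\<close> becomes a convex polynomial \<open>h\<close> whose sublevel
  sets are compact. A polynomial belongs to the preordering of \<open>c - h\<close> if it is strictly positive in
  all orderings of the polynomial ring that contain \<open>c - h\<close>, provided that one real number bounds the
  squared norm in all of them (\<open>positive_on_orderings_imp_mem\<close>). An ordering that bounds the variables has a
  standard part, which is evaluation at a real point, so the boundedness of the variables is the crux.

  Convexity provides it without a transfer principle. In a basis with least sum of the degrees of \<open>h\<close>
  along its vectors, with weights inverse to these degrees, \<open>h\<close> has a leading part that is positive
  away from the origin (\<open>adapted_basis\<close>, \<open>weighted_definite_of_adapted\<close>). If some variable were
  unbounded in an ordering with \<open>h \<le> c\<close>, then dividing by the largest scale and taking standard parts
  would produce a nonzero point at which the leading part is not positive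
  (\<open>weighted_definite_bounded\<close>).
\<close>

section \<open>Polynomials and polynomial functions\<close>

text \<open>The value of the monomial with exponents \<open>a\<close> at the point \<open>x\<close>.\<close>
definition mon_eval :: "('n::finite \<Rightarrow>\<^sub>0 nat) \<Rightarrow> real ^ 'n \<Rightarrow> real" where
  "mon_eval a x = (\<Prod>i\<in>UNIV. (x $ i) ^ Poly_Mapping.lookup a i)"

lemma mp_eval_superset:
  assumes "finite S" "Poly_Mapping.keys p \<subseteq> S"
  shows "mp_eval p x = (\<Sum>a\<in>S. Poly_Mapping.lookup p a * mon_eval a x)"
  unfolding mp_eval_def mon_eval_def
  by (rule sum.mono_neutral_left) (use assms in \<open>auto simp: in_keys_iff\<close>)

lemma mp_eval_keys: "mp_eval p x = (\<Sum>a\<in>Poly_Mapping.keys p. Poly_Mapping.lookup p a * mon_eval a x)"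
  by (rule mp_eval_superset) auto

lemma mp_eval_0 [simp]: "mp_eval 0 x = 0"
  by (simp add: mp_eval_keys)

lemma mp_eval_add [simp]: "mp_eval (p + q) x = mp_eval p x + mp_eval q x"
proof -
  let ?S = "Poly_Mapping.keys p \<union> Poly_Mapping.keys q"
  have "mp_eval (p + q) x = (\<Sum>a\<in>?S. Poly_Mapping.lookup (p + q) a * mon_eval a x)"
    by (rule mp_eval_superset) (auto simp: keys_add)
  also have "\<dots> = mp_eval p x + mp_eval q x"
    by (simp add: mp_eval_superset[of ?S p] mp_eval_superset[of ?S q] lookup_add distrib_right sum.distrib)
  finally show ?thesis .
qed

lemma mp_eval_sum [simp]: "mp_eval (\<Sum>i\<in>I. p i) x = (\<Sum>i\<in>I. mp_eval (p i) x)"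
  by (induction I rule: infinite_finite_induct) auto

lemma mon_eval_0 [simp]: "mon_eval 0 x = 1"
  by (simp add: mon_eval_def)

lemma mon_eval_add: "mon_eval (a + b) x = mon_eval a x * mon_eval b x"
  by (simp add: mon_eval_def lookup_add power_add prod.distrib)

lemma mp_eval_single [simp]: "mp_eval (Poly_Mapping.single a r) x = r * mon_eval a x"
  by (subst mp_eval_superset[of "{a}"]) auto

lemma mpoly_sum_singles:
  fixes p :: "'a \<Rightarrow>\<^sub>0 'b::comm_monoid_add"
  shows "p = (\<Sum>a\<in>Poly_Mapping.keys p. Poly_Mapping.single a (Poly_Mapping.lookup p a))"
proof (rule poly_mapping_eqI)
  fix b
  have "(\<Sum>a\<in>Poly_Mapping.keys p. (Poly_Mapping.lookup p a when a = b)) = Poly_Mapping.lookup p b"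
    by (cases "b \<in> Poly_Mapping.keys p") (auto simp: when_def in_keys_iff)
  then show "Poly_Mapping.lookup p b =
      Poly_Mapping.lookup (\<Sum>a\<in>Poly_Mapping.keys p. Poly_Mapping.single a (Poly_Mapping.lookup p a)) b"
    by (simp add: lookup_sum lookup_single)
qed

lemma mp_eval_mult [simp]: "mp_eval (p * q) x = mp_eval p x * mp_eval q x"
proof -
  have "mp_eval (p * q) x =
     mp_eval ((\<Sum>a\<in>Poly_Mapping.keys p. Poly_Mapping.single a (Poly_Mapping.lookup p a)) *
       (\<Sum>b\<in>Poly_Mapping.keys q. Poly_Mapping.single b (Poly_Mapping.lookup q b))) x"
    by (simp flip: mpoly_sum_singles)
  also have "\<dots> = mp_eval p x * mp_eval q x"
    by (simp add: sum_product mult_single mon_eval_add mp_eval_keys[of p] mp_eval_keys[of q] mult_ac)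
  finally show ?thesis .
qed

lemma mp_eval_const [simp]: "mp_eval (mp_const r) x = r"
  by (simp add: mp_const_def)

lemma mp_eval_uminus [simp]: "mp_eval (- p) x = - mp_eval p x"
proof -
  have "mp_eval (- p) x + mp_eval p x = 0" by (simp flip: mp_eval_add)
  then show ?thesis by linarith
qed

lemma mp_eval_diff [simp]: "mp_eval (p - q) x = mp_eval p x - mp_eval q x"
  using mp_eval_add[of p "-q" x] by simp

lemma mp_const_add: "mp_const (a + b) = mp_const a + mp_const b"
  by (simp add: mp_const_def single_add)

lemma mp_const_mult: "mp_const (a * b) = mp_const a * mp_const b"
  by (simp add: mp_const_def mult_single)

lemma mp_const_0 [simp]: "mp_const 0 = 0" and mp_const_1 [simp]: "mp_const 1 = 1"
  by (simp_all add: mp_const_def)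

lemma mp_const_uminus: "mp_const (- a) = - mp_const a"
  by (simp add: mp_const_def single_uminus)

lemma mp_const_diff: "mp_const (a - b) = mp_const a - mp_const b"
  by (simp add: mp_const_def single_diff)

lemma mp_const_power: "mp_const (a ^ k) = mp_const a ^ k"
  by (induction k) (auto simp: mp_const_mult)

lemma mp_eval_1 [simp]: "mp_eval 1 x = 1"
  using mp_eval_const[of 1 x] by simp

lemma mp_eval_numeral [simp]: "mp_eval (numeral k) x = numeral k"
  using mp_eval_const[of "numeral k" x] by (simp add: mp_const_def)

lemma mp_eval_power [simp]: "mp_eval (p ^ k) x = mp_eval p x ^ k"
  by (induction k) auto

lemma mp_eval_prod [simp]: "mp_eval (\<Prod>i\<in>I. p i) x = (\<Prod>i\<in>I. mp_eval (p i) x)"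
  by (induction I rule: infinite_finite_induct) auto

text \<open>The variable \<open>i\<close> as a polynomial.\<close>
definition mp_var :: "'n::finite \<Rightarrow> 'n mpoly" where
  "mp_var i = Poly_Mapping.single (Poly_Mapping.single i 1) 1"

lemma mp_eval_var [simp]: "mp_eval (mp_var i) x = x $ i"
proof -
  have "(\<Prod>j\<in>UNIV. (x $ j) ^ (1 when i = j)) = (\<Prod>j\<in>UNIV. if i = j then x $ j else 1)"
    by (rule prod.cong) (auto simp: when_def)
  then show ?thesis by (simp add: mp_var_def mon_eval_def lookup_single)
qed

text \<open>A linear combination of monomials in the variables of \<open>I\<close> with pairwise different exponents has
  zero coefficients if it vanishes identically. In the inductive step the combination is read as a
  univariate polynomial in the new variable, and its coefficients are treated one at a time.\<close>
lemma vanishing_coeffs: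
  fixes c :: "('n::finite \<Rightarrow>\<^sub>0 nat) \<Rightarrow> real"
  assumes "finite I" "finite F"
    and "inj_on (\<lambda>a. restrict (Poly_Mapping.lookup a) I) F"
    and "\<And>x. (\<Sum>a\<in>F. c a * (\<Prod>i\<in>I. x i ^ Poly_Mapping.lookup a i)) = 0"
  shows "\<forall>a\<in>F. c a = 0"
  using assms
proof (induction I arbitrary: F rule: finite_induct)
  case empty
  show ?case
  proof
    fix a assume a: "a \<in> F"
    have "b = a" if "b \<in> F" for b
      using inj_onD[OF empty.prems(2) _ that a] by (auto simp: restrict_def)
    then have "F = {a}" using a by blast
    then show "c a = 0" using empty.prems(3)[of undefined] by simp
  qed
next
  case (insert j I)
  show ?case
  proof
    fix a0 assume a0: "a0 \<in> F"
    define k where "k = Poly_Mapping.lookup a0 j"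
    define Fk where "Fk = {a\<in>F. Poly_Mapping.lookup a j = k}"
    have "(\<Sum>a\<in>Fk. c a * (\<Prod>i\<in>I. x i ^ Poly_Mapping.lookup a i)) = 0" for x
    proof -
      let ?P = "\<lambda>a. \<Prod>i\<in>I. x i ^ Poly_Mapping.lookup a i"
      define q where "q = (\<Sum>a\<in>F. monom (c a * ?P a) (Poly_Mapping.lookup a j))"
      have "poly q t = 0" for t
      proof -
        have "poly q t = (\<Sum>a\<in>F. c a * (\<Prod>i\<in>insert j I. (x(j:=t)) i ^ Poly_Mapping.lookup a i))"
          unfolding q_def poly_sum
        proof (rule sum.cong[OF refl])
          fix a assume "a \<in> F"
          have "(\<Prod>i\<in>I. (x(j:=t)) i ^ Poly_Mapping.lookup a i) = ?P a"
            by (rule prod.cong) (use insert.hyps in auto)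
          then show "poly (monom (c a * ?P a) (Poly_Mapping.lookup a j)) t
            = c a * (\<Prod>i\<in>insert j I. (x(j:=t)) i ^ Poly_Mapping.lookup a i)"
            using insert.hyps by (simp add: poly_monom mult_ac)
        qed
        then show ?thesis using insert.prems(3)[of "x(j:=t)"] by (rule trans)
      qed
      then have "q = 0" by (metis poly_all_0_iff_0)
      then have "coeff q k = 0" by simp
      moreover have "coeff q k = (\<Sum>a\<in>Fk. c a * ?P a)"
        unfolding q_def coeff_sum Fk_def using insert.prems(1)
        by (simp add: sum.inter_filter)
      ultimately show ?thesis by simp
    qed
    moreover have "inj_on (\<lambda>a. restrict (Poly_Mapping.lookup a) I) Fk"
    proof (rule inj_onI)
      fix a b assume ab: "a \<in> Fk" "b \<in> Fk"
        and eq: "restrict (Poly_Mapping.lookup a) I = restrict (Poly_Mapping.lookup b) I"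
      have "Poly_Mapping.lookup a i = Poly_Mapping.lookup b i" if "i \<in> insert j I" for i
        using that ab fun_cong[OF eq, of i] by (auto simp: Fk_def restrict_def split: if_splits)
      then have "restrict (Poly_Mapping.lookup a) (insert j I) = restrict (Poly_Mapping.lookup b) (insert j I)"
        by (auto simp: restrict_def)
      moreover have "a \<in> F" "b \<in> F" using ab by (simp_all add: Fk_def)
      ultimately show "a = b" by (rule inj_onD[OF insert.prems(2)])
    qed
    moreover have "finite Fk" using insert.prems(1) by (simp add: Fk_def)
    ultimately have "\<forall>a\<in>Fk. c a = 0" by (intro insert.IH)
    moreover have "a0 \<in> Fk" using a0 by (simp add: Fk_def k_def)
    ultimately show "c a0 = 0" by (rule bspec)
  qed
qed

lemma mon_combination_eq_0:
  fixes c :: "('n::finite \<Rightarrow>\<^sub>0 nat) \<Rightarrow> real"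
  assumes "finite F" "\<And>x. (\<Sum>a\<in>F. c a * mon_eval a x) = 0" "a \<in> F"
  shows "c a = 0"
proof -
  have "inj_on (\<lambda>a. restrict (Poly_Mapping.lookup a) (UNIV::'n set)) F"
  proof (rule inj_onI)
    fix a b :: "'n \<Rightarrow>\<^sub>0 nat"
    assume eq: "restrict (Poly_Mapping.lookup a) UNIV = restrict (Poly_Mapping.lookup b) UNIV"
    show "a = b" using fun_cong[OF eq] by (intro poly_mapping_eqI) (auto simp: restrict_def)
  qed
  moreover have "(\<Sum>a\<in>F. c a * (\<Prod>i\<in>UNIV. x i ^ Poly_Mapping.lookup a i)) = 0" for x
    using assms(2)[of "\<chi> i. x i"] by (simp add: mon_eval_def)
  ultimately show ?thesis using vanishing_coeffs[of UNIV F c] assms by auto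
qed

text \<open>Polynomials with the same values are equal, so that identities between polynomials can be proved
  by evaluation.\<close>
lemma mp_eqI:
  assumes "\<And>x. mp_eval p x = mp_eval q x"
  shows "p = q"
proof -
  have "(\<Sum>a\<in>Poly_Mapping.keys (p - q). Poly_Mapping.lookup (p - q) a * mon_eval a x) = 0" for x
    using assms[of x] by (simp flip: mp_eval_keys)
  then have "\<forall>a\<in>Poly_Mapping.keys (p - q). Poly_Mapping.lookup (p - q) a = 0"
    using mon_combination_eq_0[of "Poly_Mapping.keys (p - q)" "Poly_Mapping.lookup (p - q)"] by auto
  then have "Poly_Mapping.lookup (p - q) a = 0" for a by (auto simp: in_keys_iff)
  then have "p - q = 0" by (intro poly_mapping_eqI) simp
  then show ?thesis by simp
qed

lemma mpoly_expand:
  "p = (\<Sum>a\<in>Poly_Mapping.keys p. mp_const (Poly_Mapping.lookup p a) *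
          (\<Prod>i\<in>UNIV. mp_var i ^ Poly_Mapping.lookup a i))"
  by (rule mp_eqI) (simp add: mp_eval_def[of p])

text \<open>Functions on \<open>\<real>\<^sup>n\<close> given by a polynomial.\<close>
definition polyfun :: "(real ^ 'n::finite \<Rightarrow> real) \<Rightarrow> bool" where
  "polyfun F \<longleftrightarrow> (\<exists>p. F = mp_eval p)"

lemma polyfun_mp_eval [simp]: "polyfun (mp_eval p)"
  by (auto simp: polyfun_def)

lemma polyfun_const [simp]: "polyfun (\<lambda>x. r)"
  unfolding polyfun_def by (rule exI[of _ "mp_const r"]) auto

lemma polyfun_coord [simp]: "polyfun (\<lambda>x. x $ i)"
  unfolding polyfun_def by (rule exI[of _ "mp_var i"]) auto

lemma polyfun_add [simp]: "polyfun F \<Longrightarrow> polyfun G \<Longrightarrow> polyfun (\<lambda>x. F x + G x)"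
  unfolding polyfun_def by (elim exE, rule exI, rule ext) (simp flip: mp_eval_add)

lemma polyfun_mult [simp]: "polyfun F \<Longrightarrow> polyfun G \<Longrightarrow> polyfun (\<lambda>x. F x * G x)"
  unfolding polyfun_def by (elim exE, rule exI, rule ext) (simp flip: mp_eval_mult)

lemma polyfun_power [simp]: "polyfun F \<Longrightarrow> polyfun (\<lambda>x. F x ^ k)"
  by (induction k) auto

lemma polyfun_sum [simp]: "(\<And>i. i \<in> I \<Longrightarrow> polyfun (F i)) \<Longrightarrow> polyfun (\<lambda>x. \<Sum>i\<in>I. F i x)"
  by (induction I rule: infinite_finite_induct) auto

lemma polyfun_prod [simp]: "(\<And>i. i \<in> I \<Longrightarrow> polyfun (F i)) \<Longrightarrow> polyfun (\<lambda>x. \<Prod>i\<in>I. F i x)"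
  by (induction I rule: infinite_finite_induct) auto

lemma polyfun_compose:
  fixes A :: "real ^ 'n::finite \<Rightarrow> real ^ 'm::finite"
  assumes "polyfun F" "\<And>i. polyfun (\<lambda>x. A x $ i)"
  shows "polyfun (\<lambda>x. F (A x))"
proof -
  obtain p where p: "F = mp_eval p" using assms(1) by (auto simp: polyfun_def)
  show ?thesis unfolding p mp_eval_def
    by (intro polyfun_sum polyfun_mult polyfun_const polyfun_prod polyfun_power assms)
qed

lemma polyfun_linear:
  fixes F :: "real ^ 'n::finite \<Rightarrow> real"
  assumes "linear F"
  shows "polyfun F"
proof -
  have "F x = (\<Sum>i\<in>UNIV. x $ i * F (axis i 1))" for x
  proof -
    have "F x = F (\<Sum>i\<in>UNIV. x $ i *\<^sub>R axis i 1)" by (simp add: basis_expansion flip: scalar_mult_eq_scaleR)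
    also have "\<dots> = (\<Sum>i\<in>UNIV. x $ i * F (axis i 1))"
      by (simp add: linear_sum[OF assms] linear_scale[OF assms])
    finally show ?thesis .
  qed
  then have "F = (\<lambda>x. \<Sum>i\<in>UNIV. x $ i * F (axis i 1))" by (rule ext)
  moreover have "polyfun \<dots>" by (intro polyfun_sum polyfun_mult polyfun_coord polyfun_const)
  ultimately show ?thesis by (metis (no_types))
qed

text \<open>The pullback of a polynomial along a map \<open>A\<close>. Some such polynomial exists when \<open>A\<close> is linear,
  which all lemmas below assume.\<close>
definition mp_pull :: "(real ^ 'n::finite \<Rightarrow> real ^ 'm::finite) \<Rightarrow> 'm mpoly \<Rightarrow> 'n mpoly" where
  "mp_pull A p = (SOME q. \<forall>x. mp_eval q x = mp_eval p (A x))"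

lemma mp_eval_pull:
  assumes "linear A"
  shows "mp_eval (mp_pull A p) x = mp_eval p (A x)"
proof -
  have "linear (\<lambda>x. A x $ i)" for i
    using assms by (simp add: linear_iff)
  then have "polyfun (\<lambda>x. A x $ i)" for i by (rule polyfun_linear)
  then have "polyfun (\<lambda>x. mp_eval p (A x))"
    by (rule polyfun_compose[OF polyfun_mp_eval])
  then obtain q where "(\<lambda>x. mp_eval p (A x)) = mp_eval q" unfolding polyfun_def by (elim exE)
  then have "\<forall>x. mp_eval q x = mp_eval p (A x)" by (simp add: fun_eq_iff)
  then have "\<exists>q. \<forall>x. mp_eval q x = mp_eval p (A x)" by (rule exI)
  from someI_ex[OF this] show ?thesis by (simp add: mp_pull_def)
qed

lemma continuous_mp_eval: "continuous_on S (mp_eval p)"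
  unfolding mp_eval_def by (intro continuous_intros)

text \<open>Along a polynomial curve, and so along a line, a polynomial is a univariate polynomial in the
  curve parameter.\<close>
lemma mp_eval_curve:
  "\<exists>r. \<forall>t. mp_eval p (\<chi> i. poly (q i) t) = poly r t"
proof (intro exI allI)
  fix t
  show "mp_eval p (\<chi> i. poly (q i) t) =
    poly (\<Sum>a\<in>Poly_Mapping.keys p. smult (Poly_Mapping.lookup p a) (\<Prod>i\<in>UNIV. q i ^ Poly_Mapping.lookup a i)) t"
    by (simp add: mp_eval_def poly_sum poly_prod)
qed

lemma mp_eval_line:
  obtains r where "\<And>t. mp_eval p (x + t *\<^sub>R u) = poly r t"
proof -
  have "(\<chi> i. poly [:x $ i, u $ i:] t) = x + t *\<^sub>R u" for t
    by (simp add: vec_eq_iff)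
  then show ?thesis using mp_eval_curve[of p "\<lambda>i. [:x $ i, u $ i:]"] that by auto
qed

section \<open>Sums of squares\<close>

lemma SOS_I: "p = (\<Sum>j=1..(r::nat). (h j)\<^sup>2) \<Longrightarrow> p \<in> SOS"
  unfolding SOS_def by (rule CollectI, rule exI, rule exI)

lemma SOS_E:
  assumes "p \<in> SOS"
  obtains r h where "p = (\<Sum>j=1..(r::nat). (h j)\<^sup>2)"
  using assms unfolding SOS_def by (elim CollectE exE) (rule that)

lemma SOS_sum_squares:
  assumes "finite S"
  shows "(\<Sum>j\<in>S. (h j)\<^sup>2) \<in> SOS"
proof -
  obtain e where e: "bij_betw e {1..card S} S" using ex_bij_betw_nat_finite_1[OF assms] by blast
  have "(\<Sum>j\<in>S. (h j)\<^sup>2) = (\<Sum>j=1..card S. (h (e j))\<^sup>2)"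
    by (rule sum.reindex_bij_betw[OF e, symmetric])
  then show ?thesis by (rule SOS_I)
qed

lemma SOS_square [simp]: "p\<^sup>2 \<in> SOS"
  using SOS_sum_squares[of "{()}" "\<lambda>_. p"] by simp

lemma SOS_1 [simp]: "1 \<in> SOS"
  using SOS_square[of 1] by simp

lemma SOS_const: "r \<ge> 0 \<Longrightarrow> mp_const r \<in> SOS"
  using SOS_square[of "mp_const (sqrt r)"] by (simp flip: mp_const_power)

lemma SOS_add [simp]:
  assumes "p \<in> SOS" "q \<in> SOS"
  shows "p + q \<in> SOS"
proof -
  obtain r h where p: "p = (\<Sum>j=1..(r::nat). (h j)\<^sup>2)" using assms(1) by (rule SOS_E)
  obtain s g where q: "q = (\<Sum>j=1..(s::nat). (g j)\<^sup>2)" using assms(2) by (rule SOS_E)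
  have "p + q = (\<Sum>j\<in>{1..r} <+> {1..s}. (case_sum h g j)\<^sup>2)"
    unfolding p q by (subst sum.Plus) auto
  then show ?thesis using SOS_sum_squares[of "{1..r} <+> {1..s}" "case_sum h g"] by simp
qed

lemma SOS_mult [simp]:
  assumes "p \<in> SOS" "q \<in> SOS"
  shows "p * q \<in> SOS"
proof -
  obtain r h where p: "p = (\<Sum>j=1..(r::nat). (h j)\<^sup>2)" using assms(1) by (rule SOS_E)
  obtain s g where q: "q = (\<Sum>j=1..(s::nat). (g j)\<^sup>2)" using assms(2) by (rule SOS_E)
  have "p * q = (\<Sum>j\<in>{1..r} \<times> {1..s}. (h (fst j) * g (snd j))\<^sup>2)"
    unfolding p q sum_product sum.cartesian_product by (simp add: power_mult_distrib case_prod_beta)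
  then show ?thesis using SOS_sum_squares[of "{1..r} \<times> {1..s}" "\<lambda>j. h (fst j) * g (snd j)"] by simp
qed

lemma SOS_eval_nonneg: "p \<in> SOS \<Longrightarrow> mp_eval p x \<ge> 0"
  by (erule SOS_E) (auto intro!: sum_nonneg)

lemma SOS_pull:
  assumes "linear A" "p \<in> SOS"
  shows "mp_pull A p \<in> SOS"
proof -
  obtain r h where p: "p = (\<Sum>j=1..(r::nat). (h j)\<^sup>2)" using assms(2) by (rule SOS_E)
  have "mp_pull A p = (\<Sum>j=1..r. (mp_pull A (h j))\<^sup>2)"
    by (rule mp_eqI) (simp add: mp_eval_pull[OF assms(1)] p)
  then show ?thesis by (rule SOS_I)
qed

section \<open>Recession directions of convex polynomials\<close>

text \<open>If a convex function stays bounded above along a sequence that escapes to infinity in the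
  direction \<open>u\<close>, then it is nonincreasing in that direction from every starting point.\<close>
lemma convex_recession_seq:
  fixes F :: "'a::real_normed_vector \<Rightarrow> real"
  assumes conv: "convex_on UNIV F" and cont: "continuous_on UNIV F"
    and r: "filterlim r at_top sequentially" and lim: "(\<lambda>k. w k /\<^sub>R r k) \<longlonglongrightarrow> u"
    and M: "\<And>k. F (w k) \<le> M" and t: "t \<ge> 0"
  shows "F (x + t *\<^sub>R u) \<le> F x"
proof -
  have s0: "(\<lambda>k. t / r k) \<longlonglongrightarrow> 0"
    by (rule real_tendsto_divide_at_top[OF tendsto_const r])
  have "(\<lambda>k. (1 - t / r k) *\<^sub>R x + t *\<^sub>R (w k /\<^sub>R r k)) \<longlonglongrightarrow> (1 - 0) *\<^sub>R x + t *\<^sub>R u"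
    by (intro tendsto_intros s0 lim)
  then have "(\<lambda>k. F ((1 - t / r k) *\<^sub>R x + t *\<^sub>R (w k /\<^sub>R r k))) \<longlonglongrightarrow> F ((1 - 0) *\<^sub>R x + t *\<^sub>R u)"
    by (rule continuous_on_tendsto_compose[OF cont]) auto
  moreover have "(\<lambda>k. (1 - t / r k) * F x + t / r k * M) \<longlonglongrightarrow> (1 - 0) * F x + 0 * M"
    by (intro tendsto_intros s0)
  moreover have "\<forall>\<^sub>F k in sequentially.
      F ((1 - t / r k) *\<^sub>R x + t *\<^sub>R (w k /\<^sub>R r k)) \<le> (1 - t / r k) * F x + t / r k * M"
    using filterlim_at_top_dense[THEN iffD1, OF r, rule_format, of "max t 1"]
  proof eventually_elim
    case (elim k)
    have s: "0 \<le> t / r k" "t / r k \<le> 1" using t elim by auto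
    have "F ((1 - t / r k) *\<^sub>R x + (t / r k) *\<^sub>R w k) \<le> (1 - t / r k) * F x + t / r k * F (w k)"
      using convex_onD[OF conv s] by auto
    also have "\<dots> \<le> (1 - t / r k) * F x + t / r k * M"
      using M[of k] s by (intro add_left_mono mult_left_mono) auto
    finally show ?case by (simp add: divide_inverse)
  qed
  ultimately show ?thesis
    by (simp add: tendsto_le[OF sequentially_bot])
qed

text \<open>Being bounded above on one ray is a property of the direction of the ray only.\<close>
lemma convex_recession_ray:
  fixes F :: "'a::real_normed_vector \<Rightarrow> real"
  assumes "convex_on UNIV F" "continuous_on UNIV F" "\<And>s. s \<ge> 0 \<Longrightarrow> F (y + s *\<^sub>R u) \<le> M" "t \<ge> 0"
  shows "F (x + t *\<^sub>R u) \<le> F x"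
proof (rule convex_recession_seq[OF assms(1,2), where M = M])
  show "filterlim (\<lambda>k. real (Suc k)) at_top sequentially"
    by (rule filterlim_compose[OF filterlim_real_sequentially filterlim_Suc])
  have i0: "(\<lambda>k. inverse (real (Suc k))) \<longlonglongrightarrow> 0"
    by (rule LIMSEQ_inverse_real_of_nat)
  have "(\<lambda>k. inverse (real (Suc k)) *\<^sub>R y + u) \<longlonglongrightarrow> 0 *\<^sub>R y + u"
    by (intro tendsto_intros i0)
  moreover have "(y + real (Suc k) *\<^sub>R u) /\<^sub>R real (Suc k) = inverse (real (Suc k)) *\<^sub>R y + u" for k
    unfolding scaleR_add_right scaleR_scaleR by (simp del: of_nat_Suc)
  ultimately show "(\<lambda>k. (y + real (Suc k) *\<^sub>R u) /\<^sub>R real (Suc k)) \<longlonglongrightarrow> u"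
    by (simp del: of_nat_Suc)
qed (use assms in auto)

lemma convex_const_direction:
  fixes F :: "'a::real_normed_vector \<Rightarrow> real"
  assumes "convex_on UNIV F" "continuous_on UNIV F" "\<And>s. F (y + s *\<^sub>R u) \<le> M"
  shows "F (x + t *\<^sub>R u) = F x"
proof -
  have pos: "F (z + s *\<^sub>R u) \<le> F z" if "s \<ge> 0" for z s
    using convex_recession_ray[OF assms(1,2) assms(3) that] .
  have neg: "F (z + s *\<^sub>R (- u)) \<le> F z" if "s \<ge> 0" for z s
    using convex_recession_ray[OF assms(1,2) _ that, of y "-u" M] assms(3)[of "- _"] by simp
  show ?thesis
  proof (cases "t \<ge> 0")
    case True
    then show ?thesis using pos[of t x] neg[of t "x + t *\<^sub>R u"] by simp
  next
    case False
    then show ?thesis using neg[of "- t" x] pos[of "- t" "x + t *\<^sub>R u"] by simp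
  qed
qed

lemma poly_bounded_const:
  fixes q :: "real poly"
  assumes "\<And>t. t \<ge> 0 \<Longrightarrow> \<bar>poly q t\<bar> \<le> M"
  shows "degree q = 0"
proof (rule ccontr)
  assume "degree q \<noteq> 0"
  then have "filterlim (poly q) at_infinity at_infinity"
    by (intro filterlim_poly_at_infinity) auto
  then have "filterlim (poly q) at_infinity at_top"
    using filterlim_mono at_top_le_at_infinity by blast
  then have "\<forall>\<^sub>F t in at_top. M + 1 \<le> norm (poly q t)"
    using filterlim_at_infinity_imp_norm_at_top[of "poly q"] by (simp add: filterlim_at_top)
  moreover have "\<forall>\<^sub>F t::real in at_top. t \<ge> 0" by (rule eventually_ge_at_top)
  ultimately have "\<forall>\<^sub>F t::real in at_top. False"
    by eventually_elim (use assms in fastforce)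
  then show False by simp
qed

text \<open>Convexity turns boundedness on a single ray into invariance under all translations in its
  direction: a bounded univariate polynomial is constant, hence bounded above on the whole line.\<close>
lemma mp_const_on_bounded_ray:
  assumes "convex_on UNIV (mp_eval p)" "\<And>t. t \<ge> 0 \<Longrightarrow> \<bar>mp_eval p (y + t *\<^sub>R u)\<bar> \<le> M"
  shows "mp_eval p (x + t *\<^sub>R u) = mp_eval p x"
proof -
  obtain q where q: "\<And>t. mp_eval p (y + t *\<^sub>R u) = poly q t" using mp_eval_line by blast
  then have "degree q = 0" using assms(2) by (intro poly_bounded_const) auto
  then obtain c where "q = [:c:]" by (metis degree_eq_zeroE)
  then have "mp_eval p (y + s *\<^sub>R u) \<le> c" for s using q by simp
  then show ?thesis by (rule convex_const_direction[OF assms(1) continuous_mp_eval])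
qed

text \<open>An unbounded sequence has a subsequence that escapes to infinity in one direction.\<close>
lemma escaping_direction:
  fixes w :: "nat \<Rightarrow> 'a::euclidean_space"
  assumes "\<not> bounded (range w)"
  obtains s u where "filterlim (\<lambda>k. norm (w (s k))) at_top sequentially"
    "(\<lambda>k. w (s k) /\<^sub>R norm (w (s k))) \<longlonglongrightarrow> u" "norm u = 1"
proof -
  have "\<exists>j. norm (w j) > real (Suc k)" for k
    using assms unfolding bounded_iff by (metis (no_types, lifting) imageE not_le)
  then obtain a where a: "\<And>k. norm (w (a k)) > real (Suc k)" by metis
  have "w (a k) /\<^sub>R norm (w (a k)) \<in> sphere 0 1" for k
    using a[of k] by (auto simp: divide_simps)
  then have "\<forall>k. (\<lambda>k. w (a k) /\<^sub>R norm (w (a k))) k \<in> sphere (0::'a) 1" by blast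
  then obtain u s where us: "u \<in> sphere (0::'a) 1" "strict_mono s"
      "((\<lambda>k. w (a k) /\<^sub>R norm (w (a k))) \<circ> s) \<longlonglongrightarrow> u"
    by (rule seq_compactE[OF compact_imp_seq_compact[OF compact_sphere]])
  have "norm (w (a (s k))) \<ge> real k" for k
    using a[of "s k"] seq_suble[OF us(2), of k] by linarith
  then have "filterlim (\<lambda>k. norm (w (a (s k)))) at_top sequentially"
    by (intro filterlim_at_top_mono[OF filterlim_real_sequentially]) auto
  with us show ?thesis by (intro that[of "a \<circ> s" u]) (auto simp: o_def)
qed

section \<open>Zero duality gap for convex polynomials\<close>

text \<open>A finite system of convex polynomial inequalities that can be solved up to every positive
  tolerance can be solved exactly. Take solutions of least norm for tolerances tending to zero. If
  they escape to infinity, in the direction \<open>u\<close>, no polynomial of the system increases along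
  \<open>u\<close>. Not all of them are constant along \<open>u\<close>, by minimality of the norm. Those which are constant
  form a smaller system; moving one of its solutions far along \<open>u\<close> satisfies the others as well.\<close>
lemma convex_system_exact:
  fixes p :: "'i \<Rightarrow> 'n::finite mpoly"
  assumes "finite I" "\<And>i. i \<in> I \<Longrightarrow> convex_on UNIV (mp_eval (p i))"
    and "\<And>\<delta>. \<delta> > 0 \<Longrightarrow> \<exists>x. \<forall>i\<in>I. mp_eval (p i) x \<le> \<delta>"
  shows "\<exists>x. \<forall>i\<in>I. mp_eval (p i) x \<le> 0"
  using assms
proof (induction I rule: finite_psubset_induct)
  case (psubset I)
  define S where "S k = {x. \<forall>i\<in>I. mp_eval (p i) x \<le> inverse (real (Suc k))}" for k
  have "closed (S k)" for k
  proof -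
    have "S k = (\<Inter>i\<in>I. {x. mp_eval (p i) x \<le> inverse (real (Suc k))})" by (auto simp: S_def)
    also have "closed \<dots>"
      by (intro closed_INT ballI closed_Collect_le continuous_mp_eval continuous_on_const)
    finally show ?thesis .
  qed
  moreover have "S k \<noteq> {}" for k
    using psubset.prems(2)[of "inverse (real (Suc k))"] by (auto simp: S_def simp del: of_nat_Suc)
  ultimately have "\<exists>x. x \<in> S k \<and> (\<forall>y\<in>S k. norm x \<le> norm y)" for k
    using distance_attains_inf[of "S k" 0] by (metis dist_0_norm)
  then obtain w where w: "\<And>k. w k \<in> S k" "\<And>k y. y \<in> S k \<Longrightarrow> norm (w k) \<le> norm y" by metis
  show ?case
  proof (cases "bounded (range w)")
    case True
    then obtain l r where l: "strict_mono r" "(w \<circ> r) \<longlonglongrightarrow> l"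
      using bounded_imp_convergent_subsequence by blast
    have "mp_eval (p i) l \<le> 0" if i: "i \<in> I" for i
    proof (rule tendsto_le[OF sequentially_bot])
      show "(\<lambda>k. mp_eval (p i) ((w \<circ> r) k)) \<longlonglongrightarrow> mp_eval (p i) l"
        by (rule continuous_on_tendsto_compose[OF continuous_mp_eval[of UNIV] l(2)]) auto
      show "(\<lambda>k. inverse (real (Suc (r k)))) \<longlonglongrightarrow> 0"
        using LIMSEQ_subseq_LIMSEQ[OF LIMSEQ_inverse_real_of_nat l(1)] by (simp add: o_def)
      show "\<forall>\<^sub>F k in sequentially. mp_eval (p i) ((w \<circ> r) k) \<le> inverse (real (Suc (r k)))"
        using w(1) i by (auto simp: S_def)
    qed
    then show ?thesis by blast
  next
    case False
    then obtain s u where su: "filterlim (\<lambda>k. norm (w (s k))) at_top sequentially"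
      "(\<lambda>k. w (s k) /\<^sub>R norm (w (s k))) \<longlonglongrightarrow> u" "norm u = 1"
      by (rule escaping_direction)
    have rec: "mp_eval (p i) (x + t *\<^sub>R u) \<le> mp_eval (p i) x" if "i \<in> I" "t \<ge> 0" for i x t
    proof (rule convex_recession_seq[OF psubset.prems(1)[OF that(1)] continuous_mp_eval su(1,2) _ that(2)])
      fix k
      have "mp_eval (p i) (w (s k)) \<le> inverse (real (Suc (s k)))"
        using w(1)[of "s k"] that by (auto simp: S_def)
      also have "\<dots> \<le> 1" by (simp add: field_simps)
      finally show "mp_eval (p i) (w (s k)) \<le> 1" .
    qed
    define I0 where "I0 = {i\<in>I. \<forall>x t. mp_eval (p i) (x + t *\<^sub>R u) = mp_eval (p i) x}"
    have "I0 \<noteq> I"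
    proof
      assume I0: "I0 = I"
      \<comment> \<open>Removing from a least-norm solution its component along \<open>u\<close> gives a shorter solution.\<close>
      have "(\<lambda>k. (w (s k) /\<^sub>R norm (w (s k))) \<bullet> u) \<longlonglongrightarrow> u \<bullet> u"
        by (intro tendsto_intros su)
      moreover have "u \<bullet> u = 1" using su(3) by (simp add: dot_square_norm)
      ultimately have "\<forall>\<^sub>F k in sequentially. (w (s k) /\<^sub>R norm (w (s k))) \<bullet> u > 0"
        by (auto intro: order_tendstoD(1))
      then obtain k where k: "(w (s k) /\<^sub>R norm (w (s k))) \<bullet> u > 0"
        by (meson eventually_happens sequentially_bot)
      define y where "y = w (s k)"
      have yu: "y \<bullet> u \<noteq> 0" using k by (auto simp: y_def)
      let ?y = "y + (- (y \<bullet> u)) *\<^sub>R u"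
      have "mp_eval (p i) ?y = mp_eval (p i) y" if "i \<in> I" for i
        using that I0 unfolding I0_def by blast
      then have "?y \<in> S (s k)" using w(1)[of "s k"] by (auto simp: S_def y_def)
      then have "norm y \<le> norm ?y" using w(2) by (simp add: y_def)
      then have "y \<bullet> y \<le> ?y \<bullet> ?y" by (simp add: norm_le)
      also have "?y \<bullet> ?y = y \<bullet> y - (y \<bullet> u)\<^sup>2"
        using \<open>u \<bullet> u = 1\<close> by (simp add: inner_add inner_diff inner_commute power2_eq_square algebra_simps)
      finally show False using yu by simp
    qed
    then have "I0 \<subset> I" unfolding I0_def by blast
    have "\<exists>x. \<forall>i\<in>I0. mp_eval (p i) x \<le> 0"
    proof (rule psubset.IH[OF \<open>I0 \<subset> I\<close>])
      show "convex_on UNIV (mp_eval (p i))" if "i \<in> I0" for i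
        using that psubset.prems(1) unfolding I0_def by blast
      show "\<exists>x. \<forall>i\<in>I0. mp_eval (p i) x \<le> \<delta>" if "\<delta> > 0" for \<delta>
        using psubset.prems(2)[OF that] unfolding I0_def by blast
    qed
    then obtain x where x: "\<And>i. i \<in> I0 \<Longrightarrow> mp_eval (p i) x \<le> 0" by blast
    have "\<exists>t\<ge>0. mp_eval (p i) (x + t *\<^sub>R u) \<le> 0" if i: "i \<in> I" for i
    proof (rule ccontr)
      assume no: "\<not> (\<exists>t\<ge>0. mp_eval (p i) (x + t *\<^sub>R u) \<le> 0)"
      have "\<bar>mp_eval (p i) (x + t *\<^sub>R u)\<bar> \<le> mp_eval (p i) x" if "t \<ge> 0" for t
      proof -
        have "mp_eval (p i) (x + t *\<^sub>R u) > 0" using no that by force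
        then show ?thesis using rec[OF i that, of x] by linarith
      qed
      then have "i \<in> I0"
        unfolding I0_def using mp_const_on_bounded_ray[OF psubset.prems(1)[OF i]] i by blast
      then have "mp_eval (p i) (x + 0 *\<^sub>R u) \<le> 0" using x by simp
      with no show False by blast
    qed
    then obtain T where T: "\<And>i. i \<in> I \<Longrightarrow> T i \<ge> 0 \<and> mp_eval (p i) (x + T i *\<^sub>R u) \<le> 0" by metis
    define t where "t = sum T I"
    have "mp_eval (p i) (x + t *\<^sub>R u) \<le> 0" if i: "i \<in> I" for i
    proof -
      have "T i \<le> t" unfolding t_def using i T psubset.hyps by (intro member_le_sum) auto
      then have "mp_eval (p i) ((x + T i *\<^sub>R u) + (t - T i) *\<^sub>R u) \<le> mp_eval (p i) (x + T i *\<^sub>R u)"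
        using rec[OF i] by simp
      then show ?thesis using T[OF i] by (simp add: algebra_simps)
    qed
    then show ?thesis by blast
  qed
qed

lemma convex_on_mp_add_scaled:
  assumes "convex_on UNIV (mp_eval f)" "convex_on UNIV (mp_eval g)" "l \<ge> 0"
  shows "convex_on UNIV (mp_eval (f + mp_const l * g))"
proof -
  have "convex_on UNIV (\<lambda>x. mp_eval f x + l * mp_eval g x)"
    using assms by (intro convex_on_add convex_on_cmul)
  moreover have "mp_eval (f + mp_const l * g) = (\<lambda>x. mp_eval f x + l * mp_eval g x)" by auto
  ultimately show ?thesis by simp
qed

text \<open>One constraint is moved into the objective. The set of the pairs that dominate
  \<open>(g x, f x)\<close> for some \<open>x\<close> is separated from the pair \<open>(0, v - \<epsilon>)\<close>; exact solvability of convex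
  systems keeps this pair out of the closure, so that no constraint qualification is needed.\<close>
lemma lagrange_step:
  fixes f g :: "'n::finite mpoly" and h :: "'i \<Rightarrow> 'n mpoly"
  assumes I: "finite I" "\<And>i. i \<in> I \<Longrightarrow> convex_on UNIV (mp_eval (h i))"
    and f: "convex_on UNIV (mp_eval f)" and g: "convex_on UNIV (mp_eval g)"
    and x0: "\<And>i. i \<in> I \<Longrightarrow> mp_eval (h i) x0 \<le> 0" "mp_eval g x0 \<le> 0"
    and v: "\<And>x. (\<forall>i\<in>I. mp_eval (h i) x \<le> 0) \<Longrightarrow> mp_eval g x \<le> 0 \<Longrightarrow> v \<le> mp_eval f x"
    and e: "\<epsilon> > 0"
  obtains l where "l \<ge> 0" "\<And>x. (\<forall>i\<in>I. mp_eval (h i) x \<le> 0) \<Longrightarrow> v - \<epsilon> \<le> mp_eval f x + l * mp_eval g x"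
proof -
  define C where "C = {(a, b). \<exists>x. (\<forall>i\<in>I. mp_eval (h i) x \<le> 0) \<and> mp_eval g x \<le> a \<and> mp_eval f x \<le> b}"
  have conv: "mp_eval q (s *\<^sub>R x + t *\<^sub>R y) \<le> s * a + t * b"
    if "convex_on UNIV (mp_eval q)" "mp_eval q x \<le> a" "mp_eval q y \<le> b" "s \<ge> 0" "t \<ge> 0" "s + t = 1"
    for q :: "'n mpoly" and x y s t a b
  proof -
    have "mp_eval q (s *\<^sub>R x + t *\<^sub>R y) \<le> s * mp_eval q x + t * mp_eval q y"
      using that unfolding convex_on_def by blast
    also have "\<dots> \<le> s * a + t * b" using that by (intro add_mono mult_left_mono)
    finally show ?thesis .
  qed
  have "convex C"
  proof (rule convexI)
    fix y z :: "real \<times> real" and s t :: real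
    assume y: "y \<in> C" and z: "z \<in> C" and st: "0 \<le> s" "0 \<le> t" "s + t = 1"
    obtain x where x: "\<And>i. i \<in> I \<Longrightarrow> mp_eval (h i) x \<le> 0" "mp_eval g x \<le> fst y" "mp_eval f x \<le> snd y"
      using y unfolding C_def case_prod_beta mem_Collect_eq by blast
    obtain x' where x': "\<And>i. i \<in> I \<Longrightarrow> mp_eval (h i) x' \<le> 0" "mp_eval g x' \<le> fst z" "mp_eval f x' \<le> snd z"
      using z unfolding C_def case_prod_beta mem_Collect_eq by blast
    let ?x = "s *\<^sub>R x + t *\<^sub>R x'"
    have "\<forall>i\<in>I. mp_eval (h i) ?x \<le> 0" using conv[OF I(2) x(1) x'(1) st] by simp
    moreover have "mp_eval g ?x \<le> fst (s *\<^sub>R y + t *\<^sub>R z)" using conv[OF g x(2) x'(2) st] by simp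
    moreover have "mp_eval f ?x \<le> snd (s *\<^sub>R y + t *\<^sub>R z)" using conv[OF f x(3) x'(3) st] by simp
    ultimately show "s *\<^sub>R y + t *\<^sub>R z \<in> C" unfolding C_def by (auto simp: case_prod_beta)
  qed
  have notin: "(0, v - \<epsilon>) \<notin> closure C"
  proof
    assume cl: "(0, v - \<epsilon>) \<in> closure C"
    define p where "p = case_option (f - mp_const (v - \<epsilon>)) (case_option g h)"
    have "convex_on UNIV (mp_eval (f + mp_const 1 * mp_const (- (v - \<epsilon>))))"
      by (intro convex_on_mp_add_scaled f) (auto simp: convex_on_def algebra_simps simp flip: distrib_right)
    then have f': "convex_on UNIV (mp_eval (f - mp_const (v - \<epsilon>)))" by (simp add: mp_const_diff algebra_simps)
    have "\<exists>x. \<forall>i\<in>insert None (insert (Some None) ((Some \<circ> Some) ` I)). mp_eval (p i) x \<le> 0"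
    proof (rule convex_system_exact)
      fix \<delta> :: real assume "\<delta> > 0"
      then obtain c where c: "c \<in> C" "dist c (0, v - \<epsilon>) < \<delta>"
        using cl by (auto simp: closure_approachable)
      have "fst c \<le> \<delta>" "snd c \<le> v - \<epsilon> + \<delta>"
        using dist_fst_le[of c "(0, v - \<epsilon>)"] dist_snd_le[of c "(0, v - \<epsilon>)"] c(2)
        by (auto simp: dist_real_def)
      moreover obtain x where "\<forall>i\<in>I. mp_eval (h i) x \<le> 0" "mp_eval g x \<le> fst c" "mp_eval f x \<le> snd c"
        using c(1) unfolding C_def case_prod_beta mem_Collect_eq by blast
      ultimately show "\<exists>x. \<forall>i\<in>insert None (insert (Some None) ((Some \<circ> Some) ` I)). mp_eval (p i) x \<le> \<delta>"
        using \<open>\<delta> > 0\<close> by (intro exI[of _ x]) (fastforce simp: p_def)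
    qed (use I f' g in \<open>auto simp: p_def\<close>)
    then obtain x where "\<forall>i\<in>I. mp_eval (h i) x \<le> 0" "mp_eval g x \<le> 0" "mp_eval f x \<le> v - \<epsilon>"
      by (auto simp: p_def)
    with v[of x] e show False by simp
  qed
  obtain ab d where sep: "ab \<bullet> (0, v - \<epsilon>) < d" "\<And>x. x \<in> closure C \<Longrightarrow> d < ab \<bullet> x"
    using separating_hyperplane_closed_point[OF convex_closure[OF \<open>convex C\<close>] closed_closure notin] by blast
  obtain a b where ab: "ab = (a, b)" by force
  have sep1: "b * (v - \<epsilon>) < d" using sep(1) by (simp add: ab)
  have sep2: "d < a * y + b * z" if "(y, z) \<in> C" for y z
    using sep(2)[of "(y, z)"] that closure_subset by (force simp: ab)
  have inC: "(mp_eval g x0 + s, mp_eval f x0 + t) \<in> C" if "s \<ge> 0" "t \<ge> 0" for s t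
    using x0 that by (auto simp: C_def intro!: exI[of _ x0])
  have nonneg: "c \<ge> 0" if "\<And>s. s \<ge> 0 \<Longrightarrow> d < c * s + e" for c e :: real
  proof (rule ccontr)
    assume c: "\<not> c \<ge> 0"
    then have "d < c * (\<bar>d - e\<bar> / (- c)) + e" by (intro that divide_nonneg_pos) auto
    also have "\<dots> = e - \<bar>d - e\<bar>" using c by simp
    finally show False by linarith
  qed
  have "a \<ge> 0"
    by (rule nonneg[of _ "a * mp_eval g x0 + b * mp_eval f x0"])
       (use sep2[OF inC[OF _ order_refl]] in \<open>simp add: algebra_simps\<close>)
  have "b \<ge> 0"
    by (rule nonneg[of _ "a * mp_eval g x0 + b * mp_eval f x0"])
       (use sep2[OF inC[OF order_refl]] in \<open>simp add: algebra_simps\<close>)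
  \<comment> \<open>A vertical separating line is excluded by the feasible point \<open>x0\<close>.\<close>
  have "b \<noteq> 0"
  proof
    assume "b = 0"
    then have "0 < d" using sep1 by simp
    moreover have "d < a * mp_eval g x0" using sep2[OF inC[of 0 0]] \<open>b = 0\<close> by simp
    moreover have "a * mp_eval g x0 \<le> 0" using \<open>a \<ge> 0\<close> x0(2) by (rule mult_nonneg_nonpos)
    ultimately show False by simp
  qed
  then have b: "b > 0" using \<open>b \<ge> 0\<close> by simp
  show ?thesis
  proof (rule that[of "a / b"])
    show "a / b \<ge> 0" using \<open>a \<ge> 0\<close> b by simp
    fix x assume "\<forall>i\<in>I. mp_eval (h i) x \<le> 0"
    then have "(mp_eval g x, mp_eval f x) \<in> C" by (auto simp: C_def)
    from sep2[OF this] sep1 have "b * (v - \<epsilon>) < a * mp_eval g x + b * mp_eval f x" by simp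
    then show "v - \<epsilon> \<le> mp_eval f x + a / b * mp_eval g x" using b by (simp add: field_simps)
  qed
qed

text \<open>The number \<open>l i\<close> is the multiplier of the constraint \<open>g i\<close>. No constraint qualification is
  needed, but the multipliers depend on \<open>\<epsilon>\<close>.\<close>
theorem convex_polynomial_zero_duality_gap:
  fixes f :: "'n::finite mpoly" and g :: "'i \<Rightarrow> 'n mpoly"
  assumes "finite I" "\<And>i. i \<in> I \<Longrightarrow> convex_on UNIV (mp_eval (g i))" "convex_on UNIV (mp_eval f)"
    and "\<And>i. i \<in> I \<Longrightarrow> mp_eval (g i) x0 \<le> 0"
    and "\<And>x. (\<forall>i\<in>I. mp_eval (g i) x \<le> 0) \<Longrightarrow> v \<le> mp_eval f x"
    and "\<epsilon> > 0"
  shows "\<exists>l. (\<forall>i\<in>I. l i \<ge> 0) \<and> (\<forall>x. v - \<epsilon> \<le> mp_eval f x + (\<Sum>i\<in>I. l i * mp_eval (g i) x))"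
  using assms
proof (induction I arbitrary: f v \<epsilon> rule: finite_induct)
  case empty
  have "v - \<epsilon> \<le> mp_eval f x" for x using empty.prems(4)[of x] empty.prems(5) by simp
  then show ?case by simp
next
  case (insert j I)
  obtain a where a: "a \<ge> 0"
    "\<And>x. (\<forall>i\<in>I. mp_eval (g i) x \<le> 0) \<Longrightarrow> v - \<epsilon> / 2 \<le> mp_eval f x + a * mp_eval (g j) x"
  proof (rule lagrange_step[of I g f "g j" x0 v "\<epsilon> / 2"])
    show "v \<le> mp_eval f x" if "\<forall>i\<in>I. mp_eval (g i) x \<le> 0" "mp_eval (g j) x \<le> 0" for x
      using insert.prems(4) that by blast
  qed (use insert.prems insert.hyps in auto)
  have "\<exists>l. (\<forall>i\<in>I. l i \<ge> 0) \<and> (\<forall>x. (v - \<epsilon> / 2) - \<epsilon> / 2 \<le>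
      mp_eval (f + mp_const a * g j) x + (\<Sum>i\<in>I. l i * mp_eval (g i) x))"
  proof (rule insert.IH)
    show "convex_on UNIV (mp_eval (f + mp_const a * g j))"
      using insert.prems a(1) by (intro convex_on_mp_add_scaled) auto
    show "v - \<epsilon> / 2 \<le> mp_eval (f + mp_const a * g j) x" if "\<forall>i\<in>I. mp_eval (g i) x \<le> 0" for x
      using a(2)[OF that] by simp
  qed (use insert.prems in auto)
  then obtain l where l: "\<And>i. i \<in> I \<Longrightarrow> l i \<ge> 0"
    "\<And>x. v - \<epsilon> \<le> mp_eval f x + a * mp_eval (g j) x + (\<Sum>i\<in>I. l i * mp_eval (g i) x)"
    by auto
  have "(\<Sum>i\<in>insert j I. (l(j := a)) i * mp_eval (g i) x) =
      a * mp_eval (g j) x + (\<Sum>i\<in>I. l i * mp_eval (g i) x)" for x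
  proof -
    have "(\<Sum>i\<in>I. (l(j := a)) i * mp_eval (g i) x) = (\<Sum>i\<in>I. l i * mp_eval (g i) x)"
      by (rule sum.cong) (use insert.hyps in auto)
    then show ?thesis using insert.hyps by simp
  qed
  then show ?case using l a(1) by (intro exI[of _ "l(j := a)"]) (auto simp: add.assoc)
qed

section \<open>Preorderings, orderings and an abstract Positivstellensatz\<close>

text \<open>A preordering of a commutative ring: closed under sums and products, and containing all squares.\<close>
definition preordering :: "'a::comm_ring_1 set \<Rightarrow> bool" where
  "preordering T \<longleftrightarrow> (\<forall>a\<in>T. \<forall>b\<in>T. a + b \<in> T \<and> a * b \<in> T) \<and> (\<forall>a. a\<^sup>2 \<in> T)"

text \<open>A proper preordering that decides the sign of every element. Its support \<open>P \<inter> - P\<close> need not be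
  zero, so that elements are only ordered up to the support.\<close>
definition ring_ordering :: "'a::comm_ring_1 set \<Rightarrow> bool" where
  "ring_ordering P \<longleftrightarrow> preordering P \<and> - 1 \<notin> P \<and> (\<forall>a. a \<in> P \<or> - a \<in> P)"

lemma preordering_add: "preordering T \<Longrightarrow> a \<in> T \<Longrightarrow> b \<in> T \<Longrightarrow> a + b \<in> T"
  and preordering_mult: "preordering T \<Longrightarrow> a \<in> T \<Longrightarrow> b \<in> T \<Longrightarrow> a * b \<in> T"
  and preordering_square: "preordering T \<Longrightarrow> c\<^sup>2 \<in> T"
  by (auto simp: preordering_def)

lemma preordering_0: "preordering T \<Longrightarrow> 0 \<in> T"
  using preordering_square[of T 0] by simp

lemma preordering_1: "preordering T \<Longrightarrow> 1 \<in> T"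
  using preordering_square[of T 1] by simp

lemma preordering_sum: "preordering T \<Longrightarrow> (\<And>i. i \<in> I \<Longrightarrow> a i \<in> T) \<Longrightarrow> (\<Sum>i\<in>I. a i) \<in> T"
  by (induction I rule: infinite_finite_induct) (auto intro: preordering_add preordering_0)

lemma preordering_prod: "preordering T \<Longrightarrow> (\<And>i. i \<in> I \<Longrightarrow> a i \<in> T) \<Longrightarrow> (\<Prod>i\<in>I. a i) \<in> T"
  by (induction I rule: infinite_finite_induct) (auto intro: preordering_mult preordering_1)

lemma preordering_power: "preordering T \<Longrightarrow> a \<in> T \<Longrightarrow> a ^ k \<in> T"
  by (induction k) (auto intro: preordering_mult preordering_1)

text \<open>The preordering generated by a preordering \<open>T\<close> and one further element.\<close>
definition adjoin :: "'a::comm_ring_1 set \<Rightarrow> 'a \<Rightarrow> 'a set" where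
  "adjoin T a = {s + t * a | s t. s \<in> T \<and> t \<in> T}"

lemma adjoinI: "s \<in> T \<Longrightarrow> t \<in> T \<Longrightarrow> s + t * a \<in> adjoin T a"
  unfolding adjoin_def by blast

lemma adjoinE:
  assumes "b \<in> adjoin T a"
  obtains s t where "s \<in> T" "t \<in> T" "b = s + t * a"
  using assms unfolding adjoin_def by blast

lemma adjoin_superset: "preordering T \<Longrightarrow> T \<subseteq> adjoin T a"
  using adjoinI[of _ T 0 a] preordering_0[of T] by auto

lemma adjoin_self: "preordering T \<Longrightarrow> a \<in> adjoin T a"
  using adjoinI[of 0 T 1 a] preordering_0[of T] preordering_1[of T] by auto

lemma preordering_adjoin:
  assumes T: "preordering T"
  shows "preordering (adjoin T a)"
  unfolding preordering_def
proof (intro conjI ballI allI)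
  fix b c assume "b \<in> adjoin T a" "c \<in> adjoin T a"
  then obtain s t s' t' where *: "s \<in> T" "t \<in> T" "b = s + t * a" "s' \<in> T" "t' \<in> T" "c = s' + t' * a"
    by (metis adjoinE)
  have "b + c = (s + s') + (t + t') * a" by (simp add: * algebra_simps)
  moreover have "s + s' \<in> T" "t + t' \<in> T" using * T by (simp_all add: preordering_add)
  ultimately show "b + c \<in> adjoin T a" by (simp add: adjoinI)
  have "b * c = (s * s' + (t * t') * a\<^sup>2) + (s * t' + t * s') * a"
    by (simp add: * algebra_simps power2_eq_square)
  moreover have "s * s' + (t * t') * a\<^sup>2 \<in> T" "s * t' + t * s' \<in> T"
    using * T by (auto intro!: preordering_add preordering_mult preordering_square)
  ultimately show "b * c \<in> adjoin T a" by (auto intro: adjoinI)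
next
  fix b show "b\<^sup>2 \<in> adjoin T a" using adjoin_superset[OF T] preordering_square[OF T] by blast
qed

text \<open>A maximal proper preordering is an ordering.\<close>
lemma preordering_extends_to_ordering:
  assumes T: "preordering (T :: 'a::comm_ring_1 set)" "- 1 \<notin> T"
  obtains P where "ring_ordering P" "T \<subseteq> P"
proof -
  define A where "A = {P. preordering P \<and> T \<subseteq> P \<and> - 1 \<notin> P}"
  have "\<exists>M\<in>A. \<forall>X\<in>A. M \<subseteq> X \<longrightarrow> X = M"
  proof (rule subset_Zorn_nonempty)
    show "A \<noteq> {}" using T by (auto simp: A_def)
    fix C assume C: "C \<noteq> {}" "subset.chain A C"
    then have sub: "C \<subseteq> A" and total: "\<And>X Y. X \<in> C \<Longrightarrow> Y \<in> C \<Longrightarrow> X \<subseteq> Y \<or> Y \<subseteq> X"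
      by (auto simp: subset_chain_def)
    have "preordering (\<Union>C)"
      unfolding preordering_def
    proof (intro conjI ballI allI)
      fix a b assume "a \<in> \<Union>C" "b \<in> \<Union>C"
      then obtain X Y where XY: "X \<in> C" "Y \<in> C" "a \<in> X" "b \<in> Y" by blast
      then obtain Z where Z: "Z \<in> C" "a \<in> Z" "b \<in> Z" using total[of X Y] by blast
      then have "preordering Z" using sub by (auto simp: A_def)
      then show "a + b \<in> \<Union>C" "a * b \<in> \<Union>C"
        using Z by (auto intro: preordering_add preordering_mult)
    next
      fix a :: 'a
      obtain X where "X \<in> C" using C(1) by blast
      then show "a\<^sup>2 \<in> \<Union>C" using sub by (auto simp: A_def intro: preordering_square)
    qed
    then show "\<Union>C \<in> A" using C(1) sub by (auto simp: A_def)
  qed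
  then obtain P where PA: "P \<in> A" and max: "\<And>X. X \<in> A \<Longrightarrow> P \<subseteq> X \<Longrightarrow> X = P" by blast
  then have P: "preordering P" "T \<subseteq> P" "- 1 \<notin> P" by (auto simp: A_def)
  have improper: "- 1 \<in> adjoin P a" if "a \<notin> P" for a
  proof (rule ccontr)
    assume "- 1 \<notin> adjoin P a"
    then have "adjoin P a \<in> A"
      using P adjoin_superset[OF P(1), of a] by (auto simp: A_def preordering_adjoin)
    then have "adjoin P a = P" using max adjoin_superset[OF P(1)] by blast
    then show False using that adjoin_self[OF P(1), of a] by blast
  qed
  have "a \<in> P \<or> - a \<in> P" for a
  proof (rule ccontr)
    assume "\<not> (a \<in> P \<or> - a \<in> P)"
    then have "- 1 \<in> adjoin P a" "- 1 \<in> adjoin P (- a)" using improper by blast+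
    then obtain s t s' t' where st: "s \<in> P" "t \<in> P" "- 1 = s + t * a" "s' \<in> P" "t' \<in> P" "- 1 = s' + t' * (- a)"
      by (metis adjoinE)
    have e1: "1 + s = - (t * a)" using st(3) by (metis add.commute add.inverse_inverse add_diff_cancel_right' diff_conv_add_uminus minus_add_distrib)
    have e2: "1 + s' = t' * a" using st(6) by (metis add.commute add.inverse_inverse add_diff_cancel_right' diff_conv_add_uminus minus_add_distrib mult_minus_right)
    have "(1 + s) * (1 + s') = - (t * t' * a\<^sup>2)"
      unfolding e1 e2 by (simp add: power2_eq_square mult_ac)
    then have "- 1 = s + s' + s * s' + t * t' * a\<^sup>2"
      by (simp add: algebra_simps eq_neg_iff_add_eq_0)
         (metis add.assoc add.commute add_eq_0_iff2 add.inverse_inverse)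
    moreover have "s + s' + s * s' + t * t' * a\<^sup>2 \<in> P"
      using st P(1) by (intro preordering_add preordering_mult preordering_square)
    ultimately show False using P(3) by simp
  qed
  then show ?thesis using that P by (auto simp: ring_ordering_def)
qed

text \<open>If \<open>q\<close> is strictly positive in every ordering above \<open>T\<close>, then the preordering generated by \<open>T\<close>
  and \<open>- q\<close> has no extension to an ordering; it contains \<open>- 1\<close>, which is the certificate.\<close>
lemma abstract_positivstellensatz:
  assumes T: "preordering T"
    and pos: "\<And>P. ring_ordering P \<Longrightarrow> T \<subseteq> P \<Longrightarrow> - q \<notin> P"
  obtains t s where "t \<in> T" "s \<in> T" "t * q = 1 + s"
proof -
  have "- 1 \<in> adjoin T (- q)"
  proof (rule ccontr)
    assume "- 1 \<notin> adjoin T (- q)"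
    then obtain P where "ring_ordering P" "adjoin T (- q) \<subseteq> P"
      using preordering_extends_to_ordering[OF preordering_adjoin[OF T]] by blast
    then show False
      using pos[of P] adjoin_superset[OF T, of "- q"] adjoin_self[OF T, of "- q"] by blast
  qed
  then obtain s t where st: "s \<in> T" "t \<in> T" "- 1 = s + t * (- q)" by (rule adjoinE)
  have "t * q = 1 + s"
  proof -
    have "1 + (s + t * (- q)) = 0" by (subst st(3)[symmetric]) simp
    then show ?thesis by (simp add: algebra_simps)
  qed
  with st show ?thesis using that by blast
qed

section \<open>Archimedean preorderings of the polynomial ring\<close>

text \<open>The polynomial whose values are the squared Euclidean norms.\<close>
definition sq_norm_poly :: "'n::finite mpoly" where
  "sq_norm_poly = (\<Sum>i\<in>UNIV. (mp_var i)\<^sup>2)"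

text \<open>A preordering for which every polynomial is bounded above by a real number.\<close>
definition archimedean_preordering :: "'n::finite mpoly set \<Rightarrow> bool" where
  "archimedean_preordering T \<longleftrightarrow> preordering T \<and> (\<forall>a. \<exists>r. mp_const r - a \<in> T)"

lemma preordering_const: "preordering T \<Longrightarrow> r \<ge> 0 \<Longrightarrow> mp_const r \<in> T"
  using preordering_square[of T "mp_const (sqrt r)"] by (simp flip: mp_const_power)

lemma mpoly_ring_induct [case_names const var add mult]:
  assumes "\<And>r. Q (mp_const r)" "\<And>i. Q (mp_var i)"
    and "\<And>p q. Q p \<Longrightarrow> Q q \<Longrightarrow> Q (p + q)" "\<And>p q. Q p \<Longrightarrow> Q q \<Longrightarrow> Q (p * q)"
  shows "Q (p :: 'n::finite mpoly)"
proof -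
  have one: "Q 1" and zero: "Q 0" using assms(1)[of 1] assms(1)[of 0] by simp_all
  have power: "Q (q ^ k)" if "Q q" for q k
    by (induction k) (use that one assms(4) in auto)
  have prod: "Q (\<Prod>i\<in>I. q i)" if "\<And>i. Q (q i)" for q and I :: "'n set"
    by (induction I rule: infinite_finite_induct) (use that one assms(4) in auto)
  have sum: "Q (\<Sum>i\<in>I. q i)" if "\<And>i. Q (q i)" for q and I :: "('n \<Rightarrow>\<^sub>0 nat) set"
    by (induction I rule: infinite_finite_induct) (use that zero assms(3) in auto)
  have "Q (\<Sum>a\<in>Poly_Mapping.keys p. mp_const (Poly_Mapping.lookup p a) *
          (\<Prod>i\<in>UNIV. mp_var i ^ Poly_Mapping.lookup a i))"
    by (intro sum assms(1,4) prod power assms(2))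
  then show ?thesis by (simp flip: mpoly_expand)
qed

text \<open>A bound for the squared norm suffices, as the bounded elements form a subring.\<close>
lemma archimedeanI:
  assumes T: "preordering T" and N: "mp_const N - sq_norm_poly \<in> T"
  shows "archimedean_preordering T"
proof -
  note [intro!] = preordering_add[OF T] preordering_mult[OF T]
  define B where "B a \<longleftrightarrow> (\<exists>r. mp_const r - a \<in> T \<and> mp_const r + a \<in> T)" for a
  have "B a" for a
  proof (induction a rule: mpoly_ring_induct)
    case (const s)
    have "mp_const \<bar>s\<bar> - mp_const s \<in> T" "mp_const \<bar>s\<bar> + mp_const s \<in> T"
      using preordering_const[OF T, of "\<bar>s\<bar> - s"] preordering_const[OF T, of "\<bar>s\<bar> + s"]
      by (simp_all add: mp_const_diff mp_const_add)
    then show ?case by (auto simp: B_def)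
  next
    case (var i)
    have "(\<Sum>j\<in>UNIV - {i}. (mp_var j)\<^sup>2) \<in> T"
      by (intro preordering_sum T preordering_square)
    then have *: "(mp_const N - sq_norm_poly) + (\<Sum>j\<in>UNIV - {i}. (mp_var j)\<^sup>2) \<in> T"
      using N by blast
    have "mp_const ((N + 1) / 2) - mp_var i = mp_const (1/2) *
      (((mp_const N - sq_norm_poly) + (\<Sum>j\<in>UNIV - {i}. (mp_var j)\<^sup>2)) + (mp_var i - 1)\<^sup>2)"
      "mp_const ((N + 1) / 2) + mp_var i = mp_const (1/2) *
      (((mp_const N - sq_norm_poly) + (\<Sum>j\<in>UNIV - {i}. (mp_var j)\<^sup>2)) + (mp_var i + 1)\<^sup>2)"
      by (rule mp_eqI, simp add: sq_norm_poly_def sum.remove[of UNIV i] power2_eq_square field_simps)+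
    then show ?case
      using * preordering_square[OF T] preordering_const[OF T, of "1/2"] unfolding B_def
      by (intro exI[of _ "(N + 1) / 2"]) (metis preordering_add[OF T] preordering_mult[OF T] divide_nonneg_nonneg zero_le_one zero_le_numeral)
  next
    case (add p q)
    then obtain r s where "mp_const r - p \<in> T" "mp_const r + p \<in> T" "mp_const s - q \<in> T" "mp_const s + q \<in> T"
      by (auto simp: B_def)
    then have "(mp_const r - p) + (mp_const s - q) \<in> T" "(mp_const r + p) + (mp_const s + q) \<in> T"
      by blast+
    then show ?case
      unfolding B_def by (intro exI[of _ "r + s"]) (simp add: mp_const_add algebra_simps)
  next
    case (mult p q)
    then obtain r s where rs: "mp_const r - p \<in> T" "mp_const r + p \<in> T" "mp_const s - q \<in> T" "mp_const s + q \<in> T"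
      by (auto simp: B_def)
    have half: "mp_const (1/2) \<in> T" by (rule preordering_const[OF T]) simp
    have "mp_const (1/2) * ((mp_const r - p) * (mp_const s + q) + (mp_const r + p) * (mp_const s - q)) \<in> T"
      "mp_const (1/2) * ((mp_const r - p) * (mp_const s - q) + (mp_const r + p) * (mp_const s + q)) \<in> T"
      using rs half by blast+
    moreover have "mp_const (1/2) * ((mp_const r - p) * (mp_const s + q) + (mp_const r + p) * (mp_const s - q))
        = mp_const (r * s) - p * q"
      "mp_const (1/2) * ((mp_const r - p) * (mp_const s - q) + (mp_const r + p) * (mp_const s + q))
        = mp_const (r * s) + p * q"
      by (rule mp_eqI, simp add: field_simps)+
    ultimately show ?case unfolding B_def by auto
  qed
  then show ?thesis using T unfolding archimedean_preordering_def B_def by blast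
qed

text \<open>Woermann's trick: a certificate for the strict positivity of \<open>N - |x|\<^sup>2\<close>, which involves a
  denominator \<open>t\<close>, already makes the preordering archimedean. Adjoining \<open>N - |x|\<^sup>2\<close> gives an
  archimedean preordering, which bounds \<open>s\<close> by some \<open>l\<close>; multiplying by \<open>1 + s\<close> returns to \<open>T\<close>.\<close>
lemma archimedean_from_certificate:
  assumes T: "preordering T" and ts: "t \<in> T" "s \<in> T" "t * (mp_const N - sq_norm_poly) = 1 + s" and N: "N \<ge> 0"
  shows "archimedean_preordering T"
proof -
  note [intro!] = preordering_add[OF T] preordering_mult[OF T]
  let ?q = "mp_const N - sq_norm_poly :: 'a mpoly"
  have q: "(1 + s) * ?q \<in> T"
  proof -
    have "(1 + s) * ?q = t * ?q\<^sup>2" by (simp add: power2_eq_square mult.assoc flip: ts(3))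
    then show ?thesis using ts(1) preordering_square[OF T] by auto
  qed
  have "archimedean_preordering (adjoin T ?q)"
    by (intro archimedeanI[where N = N] preordering_adjoin adjoin_self T)
  then obtain l where "mp_const l - s \<in> adjoin T ?q" by (auto simp: archimedean_preordering_def)
  then obtain a b where ab: "a \<in> T" "b \<in> T" "mp_const l - s = a + b * ?q" by (rule adjoinE)
  define l' where "l' = l + l\<^sup>2 / 4"
  have "mp_const l' - s = (1 + s) * (mp_const l - s) + (mp_const (l / 2) - s)\<^sup>2"
    by (rule mp_eqI) (simp add: l'_def power2_eq_square field_simps)
  also have "\<dots> = ((1 + s) * a + b * ((1 + s) * ?q)) + (mp_const (l / 2) - s)\<^sup>2"
    unfolding ab(3) by (simp add: algebra_simps)
  also have "\<dots> \<in> T"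
    using q ab ts(2) preordering_square[OF T] preordering_1[OF T] by blast
  finally have l': "mp_const l' - s \<in> T" .
  have S: "sq_norm_poly \<in> T"
    unfolding sq_norm_poly_def by (intro preordering_sum T preordering_square)
  have "mp_const (N * l' + N) - sq_norm_poly = mp_const N * (mp_const l' - s) + (1 + s) * ?q + s * sq_norm_poly"
    by (rule mp_eqI) (simp add: field_simps)
  also have "\<dots> \<in> T" using l' q S ts(2) preordering_const[OF T N] by blast
  finally show ?thesis by (rule archimedeanI[OF T])
qed

text \<open>In an archimedean preordering the denominator \<open>t\<close> can be cleared: membership of \<open>p + r\<close> implies
  membership of \<open>p + (r - 1 / k\<^sup>2)\<close> with \<open>k\<close> independent of \<open>r \<ge> 0\<close>, until \<open>r\<close> becomes negative.\<close>
lemma archimedean_strictly_positive: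
  assumes A: "archimedean_preordering T" and ts: "t \<in> T" "s \<in> T" "t * p = 1 + s"
  shows "p \<in> T"
proof -
  have T: "preordering T" using A by (simp add: archimedean_preordering_def)
  note [intro!] = preordering_add[OF T] preordering_mult[OF T]
  have bound: "\<exists>r. \<forall>r'\<ge>r. mp_const r' - a \<in> T" for a
  proof -
    obtain r where r: "mp_const r - a \<in> T" using A by (auto simp: archimedean_preordering_def)
    have "mp_const r' - a \<in> T" if "r' \<ge> r" for r'
    proof -
      have "mp_const (r' - r) + (mp_const r - a) \<in> T"
        using r preordering_const[OF T, of "r' - r"] that by auto
      then show ?thesis by (simp add: mp_const_diff)
    qed
    then show ?thesis by blast
  qed
  obtain r1 r2 where r12: "\<And>r'. r' \<ge> r1 \<Longrightarrow> mp_const r' - t \<in> T" "\<And>r'. r' \<ge> r2 \<Longrightarrow> mp_const r' - (t\<^sup>2 * p + 1) \<in> T"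
    using bound by metis
  obtain r0 where r0: "mp_const r0 - (- p) \<in> T" using bound[of "- p"] by blast
  define k where "k = Max {r1, r2, 1}"
  have k: "k \<ge> 1" "2 * k \<ge> r1" "2 * k \<ge> r2" by (auto simp: k_def max_def)
  have step: "p + mp_const (r - 1 / k\<^sup>2) \<in> T" if r: "r \<ge> 0" "p + mp_const r \<in> T" for r
  proof -
    let ?rhs = "(mp_const k - t)\<^sup>2 * (p + mp_const r) + mp_const (2 * k) * s
      + mp_const r * (t * (mp_const (2 * k) - t)) + (mp_const (2 * k) - (t\<^sup>2 * p + 1))"
    \<comment> \<open>After the substitution \<open>s = t * p - 1\<close> all terms of \<open>?rhs\<close> cancel except \<open>k\<^sup>2 * (p + r) - 1\<close>.\<close>
    have "p + mp_const (r - 1 / k\<^sup>2) = mp_const (1 / k\<^sup>2) * ?rhs"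
    proof (rule mp_eqI)
      fix x
      have "mp_eval t x * mp_eval p x = 1 + mp_eval s x"
        using arg_cong[OF ts(3), of "\<lambda>q. mp_eval q x"] by simp
      then have s: "mp_eval s x = mp_eval t x * mp_eval p x - 1" by simp
      show "mp_eval (p + mp_const (r - 1 / k\<^sup>2)) x = mp_eval (mp_const (1 / k\<^sup>2) * ?rhs) x"
        using k(1) by (simp add: s) (simp add: power2_eq_square field_simps)
    qed
    also have "\<dots> \<in> T"
      using r ts(1,2) preordering_square[OF T, of "mp_const k - t"] r12(1)[OF k(2)] r12(2)[OF k(3)]
        preordering_const[OF T, of "1 / k\<^sup>2"] preordering_const[OF T, of "2 * k"] preordering_const[OF T, of r] k(1)
      by auto
    finally show ?thesis .
  qed
  have drop: "p \<in> T" if "r \<le> 0" "p + mp_const r \<in> T" for r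
  proof -
    have "p + mp_const r + mp_const (- r) \<in> T"
      using that preordering_const[OF T, of "- r"] by auto
    then show ?thesis by (simp add: mp_const_uminus)
  qed
  have "p + mp_const (r0 - real j / k\<^sup>2) \<in> T \<or> p \<in> T" for j
  proof (induction j)
    case 0
    then show ?case using r0 by (simp add: add.commute)
  next
    case (Suc j)
    then consider "p \<in> T" | "r0 - real j / k\<^sup>2 \<ge> 0" "p + mp_const (r0 - real j / k\<^sup>2) \<in> T"
      | "r0 - real j / k\<^sup>2 \<le> 0" "p + mp_const (r0 - real j / k\<^sup>2) \<in> T" by linarith
    then show ?case
    proof cases
      case 2
      then show ?thesis using step[OF 2] by (simp add: add_divide_distrib algebra_simps)
    next
      case 3
      then show ?thesis using drop by blast
    qed simp
  qed
  moreover obtain j where "real j > r0 * k\<^sup>2" using reals_Archimedean2 by blast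
  moreover have "p \<in> T" if "p + mp_const (r0 - real j / k\<^sup>2) \<in> T" "real j > r0 * k\<^sup>2" for j
  proof -
    have "r0 - real j / k\<^sup>2 \<le> 0" using that(2) k(1) by (simp add: field_simps)
    then show ?thesis using drop that(1) by blast
  qed
  ultimately show ?thesis by blast
qed

text \<open>A Positivstellensatz without denominators. The first condition on the orderings expresses, in
  algebraic terms, that the set described by \<open>T\<close> is bounded.\<close>
theorem positive_on_orderings_imp_mem:
  fixes T :: "'n::finite mpoly set"
  assumes T: "preordering T" and N: "N \<ge> 0"
    and ball: "\<And>P. ring_ordering P \<Longrightarrow> T \<subseteq> P \<Longrightarrow> - (mp_const N - sq_norm_poly) \<notin> P"
    and pos: "\<And>P. ring_ordering P \<Longrightarrow> T \<subseteq> P \<Longrightarrow> - p \<notin> P"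
  shows "p \<in> T"
proof -
  obtain t s where ts: "t \<in> T" "s \<in> T" "t * (mp_const N - sq_norm_poly) = 1 + s"
    using abstract_positivstellensatz[OF T ball] by blast
  have "archimedean_preordering T" by (rule archimedean_from_certificate[OF T ts N])
  moreover obtain t' s' where "t' \<in> T" "s' \<in> T" "t' * p = 1 + s'"
    using abstract_positivstellensatz[OF T pos] by blast
  ultimately show ?thesis by (rule archimedean_strictly_positive)
qed

text \<open>The preordering of all \<open>\<sigma>0 + \<sigma> * g\<close> with sums of squares \<open>\<sigma>0\<close> and \<open>\<sigma>\<close>.\<close>
definition gen_preordering :: "'n::finite mpoly \<Rightarrow> 'n mpoly set" where
  "gen_preordering g = adjoin SOS g"

lemma preordering_SOS: "preordering SOS"
  by (simp add: preordering_def)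

lemma preordering_gen: "preordering (gen_preordering g)"
  unfolding gen_preordering_def by (rule preordering_adjoin[OF preordering_SOS])

lemma gen_preordering_self: "g \<in> gen_preordering g"
  unfolding gen_preordering_def by (rule adjoin_self[OF preordering_SOS])

section \<open>Standard parts in an ordering of the polynomial ring\<close>

text \<open>An ordering \<open>P\<close> of the polynomial ring; \<open>a \<in> P\<close> is read as \<open>a \<ge> 0\<close>.\<close>
locale ordered_mpoly =
  fixes P :: "'n::finite mpoly set"
  assumes ord: "ring_ordering P"
begin

lemma pre: "preordering P" and minus_one: "- 1 \<notin> P" and total: "a \<in> P \<or> - a \<in> P"
  using ord by (auto simp: ring_ordering_def)

lemmas P_add = preordering_add[OF pre] and P_mult = preordering_mult[OF pre]
  and P_square = preordering_square[OF pre] and P_const = preordering_const[OF pre]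
  and P_1 = preordering_1[OF pre] and P_0 = preordering_0[OF pre]
  and P_power = preordering_power[OF pre] and P_sum = preordering_sum[OF pre]
  and P_prod = preordering_prod[OF pre]

text \<open>The element \<open>a\<close> is bounded by \<open>u\<close> in absolute value.\<close>
definition bnd :: "'n mpoly \<Rightarrow> 'n mpoly \<Rightarrow> bool" where
  "bnd a u \<longleftrightarrow> u - a \<in> P \<and> u + a \<in> P"

lemma bnd_mono: "bnd a u \<Longrightarrow> v - u \<in> P \<Longrightarrow> bnd a v"
  unfolding bnd_def using P_add[of "v - u" "u - a"] P_add[of "v - u" "u + a"] by (simp add: algebra_simps)

lemma bnd_add: "bnd a u \<Longrightarrow> bnd b v \<Longrightarrow> bnd (a + b) (u + v)"
  unfolding bnd_def using P_add[of "u - a" "v - b"] P_add[of "u + a" "v + b"] by (simp add: algebra_simps)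

lemma bnd_mult:
  assumes "bnd a u" "bnd b v"
  shows "bnd (a * b) (u * v)"
proof -
  have half: "mp_const (1/2) \<in> P" by (rule P_const) simp
  have "mp_const (1/2) * ((u - a) * (v + b) + (u + a) * (v - b)) \<in> P"
    "mp_const (1/2) * ((u - a) * (v - b) + (u + a) * (v + b)) \<in> P"
    using assms unfolding bnd_def by (auto intro!: P_add P_mult half)
  moreover have "mp_const (1/2) * ((u - a) * (v + b) + (u + a) * (v - b)) = u * v - a * b"
    "mp_const (1/2) * ((u - a) * (v - b) + (u + a) * (v + b)) = u * v + a * b"
    by (rule mp_eqI, simp add: field_simps)+
  ultimately show ?thesis by (simp add: bnd_def)
qed

lemma bnd_const: "\<bar>c\<bar> \<le> d \<Longrightarrow> bnd (mp_const c) (mp_const d)"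
  unfolding bnd_def using P_const[of "d - c"] P_const[of "d + c"]
  by (auto simp: mp_const_add mp_const_diff)

lemma power_diff_mem: "b \<in> P \<Longrightarrow> a - b \<in> P \<Longrightarrow> a ^ k - b ^ k \<in> P"
proof (induction k)
  case 0
  then show ?case by (simp add: P_0)
next
  case (Suc k)
  have "a \<in> P" using P_add[OF Suc.prems] by simp
  have "a ^ Suc k - b ^ Suc k = a * (a ^ k - b ^ k) + (a - b) * b ^ k"
    by (simp add: algebra_simps)
  also have "\<dots> \<in> P" using Suc \<open>a \<in> P\<close> by (intro P_add P_mult P_power) auto
  finally show ?case .
qed

end

text \<open>An ordering together with an element \<open>w\<close> that is at least one. The relation \<open>st k a r\<close> says
  that \<open>a / w ^ k\<close> is infinitesimally close to the real number \<open>r\<close>.\<close>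
locale ordered_mpoly_scale = ordered_mpoly P for P :: "'n::finite mpoly set" +
  fixes w :: "'n mpoly"
  assumes w1: "w - 1 \<in> P"
begin

definition st :: "nat \<Rightarrow> 'n mpoly \<Rightarrow> real \<Rightarrow> bool" where
  "st k a r \<longleftrightarrow> (\<forall>\<epsilon>>0. bnd (a - mp_const r * w ^ k) (mp_const \<epsilon> * w ^ k))"

lemma w_mem: "w \<in> P"
  using P_add[OF w1 P_1] by simp

lemma wk_mem: "w ^ k \<in> P"
  by (rule P_power[OF w_mem])

lemma wk1: "w ^ k - 1 \<in> P"
  using power_diff_mem[OF P_1 w1, of k] by simp

lemma neg_wk: "mp_const r * w ^ k \<in> P \<Longrightarrow> r \<ge> 0"
proof (rule ccontr)
  assume *: "mp_const r * w ^ k \<in> P" "\<not> r \<ge> 0"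
  have "mp_const (- 1 / r) * (mp_const r * w ^ k) + (w ^ k - 1) \<in> P"
    by (rule P_add[OF P_mult[OF P_const *(1)] wk1]) (use *(2) in \<open>auto simp: divide_simps\<close>)
  also have "mp_const (- 1 / r) * (mp_const r * w ^ k) + (w ^ k - 1) = - 1"
    by (rule mp_eqI) (use *(2) in simp)
  finally show False using minus_one by simp
qed

lemma st_exists:
  assumes "bnd a (mp_const C * w ^ k)"
  obtains r where "st k a r"
proof -
  define A where "A = {s. a - mp_const s * w ^ k \<in> P}"
  have "- C \<in> A" using assms by (simp add: A_def bnd_def mp_const_uminus add.commute)
  have ub: "s \<le> C" if "s \<in> A" for s
  proof -
    have "(mp_const C * w ^ k - a) + (a - mp_const s * w ^ k) \<in> P"
      using that assms by (intro P_add) (auto simp: A_def bnd_def)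
    then have "mp_const (C - s) * w ^ k \<in> P" by (simp add: mp_const_diff algebra_simps)
    then show ?thesis using neg_wk by fastforce
  qed
  then have bdd: "bdd_above A" by (rule bdd_aboveI)
  have "st k a (Sup A)"
    unfolding st_def bnd_def
  proof (intro allI impI conjI)
    fix \<epsilon> :: real assume e: "\<epsilon> > 0"
    have "Sup A + \<epsilon> \<notin> A" using cSup_upper[OF _ bdd, of "Sup A + \<epsilon>"] e by auto
    then have "- (a - mp_const (Sup A + \<epsilon>) * w ^ k) \<in> P"
      using total[of "a - mp_const (Sup A + \<epsilon>) * w ^ k"] by (auto simp: A_def)
    also have "- (a - mp_const (Sup A + \<epsilon>) * w ^ k) = mp_const \<epsilon> * w ^ k - (a - mp_const (Sup A) * w ^ k)"
      by (rule mp_eqI) (simp add: algebra_simps)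
    finally show "mp_const \<epsilon> * w ^ k - (a - mp_const (Sup A) * w ^ k) \<in> P" .
    obtain s where s: "s \<in> A" "s > Sup A - \<epsilon>"
      using less_cSupD[of A "Sup A - \<epsilon>"] \<open>- C \<in> A\<close> e by auto
    have "(a - mp_const s * w ^ k) + mp_const (s - (Sup A - \<epsilon>)) * w ^ k \<in> P"
      using s by (intro P_add P_mult P_const wk_mem) (auto simp: A_def)
    also have "(a - mp_const s * w ^ k) + mp_const (s - (Sup A - \<epsilon>)) * w ^ k
        = mp_const \<epsilon> * w ^ k + (a - mp_const (Sup A) * w ^ k)"
      by (rule mp_eqI) (simp add: algebra_simps)
    finally show "mp_const \<epsilon> * w ^ k + (a - mp_const (Sup A) * w ^ k) \<in> P" .
  qed
  then show ?thesis by (rule that)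
qed

lemma st_nonneg:
  assumes "st k a r" "a \<in> P"
  shows "r \<ge> 0"
proof (rule ccontr)
  assume r: "\<not> r \<ge> 0"
  then have "mp_const (- r / 2) * w ^ k - (a - mp_const r * w ^ k) + a \<in> P"
    using assms by (intro P_add) (auto simp: st_def bnd_def)
  also have "mp_const (- r / 2) * w ^ k - (a - mp_const r * w ^ k) + a = mp_const (r / 2) * w ^ k"
    by (rule mp_eqI) (simp add: algebra_simps)
  finally show False using neg_wk[of "r / 2" k] r by simp
qed

lemma st_add:
  assumes "st k a r" "st k b s"
  shows "st k (a + b) (r + s)"
  unfolding st_def
proof (intro allI impI)
  fix \<epsilon> :: real assume "\<epsilon> > 0"
  then have "bnd ((a - mp_const r * w ^ k) + (b - mp_const s * w ^ k)) (mp_const (\<epsilon>/2) * w ^ k + mp_const (\<epsilon>/2) * w ^ k)"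
    using assms by (intro bnd_add) (auto simp: st_def)
  moreover have "(a - mp_const r * w ^ k) + (b - mp_const s * w ^ k) = a + b - mp_const (r + s) * w ^ k"
    "mp_const (\<epsilon>/2) * w ^ k + mp_const (\<epsilon>/2) * w ^ k = mp_const \<epsilon> * w ^ k"
    by (rule mp_eqI, simp add: algebra_simps)+
  ultimately show "bnd (a + b - mp_const (r + s) * w ^ k) (mp_const \<epsilon> * w ^ k)" by simp
qed

lemma st_mult:
  assumes "st k a r" "st l b s"
  shows "st (k + l) (a * b) (r * s)"
  unfolding st_def
proof (intro allI impI)
  fix \<epsilon> :: real assume e: "\<epsilon> > 0"
  define \<delta> where "\<delta> = min 1 (\<epsilon> / (1 + \<bar>r\<bar> + \<bar>s\<bar>))"
  have d: "\<delta> > 0" "\<delta> \<le> 1" using e by (auto simp: \<delta>_def intro!: divide_pos_pos)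
  have "\<delta> * (1 + \<bar>r\<bar> + \<bar>s\<bar>) \<le> \<epsilon> / (1 + \<bar>r\<bar> + \<bar>s\<bar>) * (1 + \<bar>r\<bar> + \<bar>s\<bar>)"
    by (rule mult_right_mono) (auto simp: \<delta>_def)
  also have "\<dots> = \<epsilon>" using abs_ge_zero[of r] abs_ge_zero[of s] by (simp add: add_nonneg_eq_0_iff)
  finally have "\<delta> * (1 + \<bar>r\<bar> + \<bar>s\<bar>) \<le> \<epsilon>" .
  moreover have "\<delta> * \<delta> \<le> \<delta> * 1" using d by (intro mult_left_mono) auto
  ultimately have ineq: "\<delta> * \<delta> + \<bar>r\<bar> * \<delta> + \<bar>s\<bar> * \<delta> \<le> \<epsilon>" by (simp add: algebra_simps)
  have W: "bnd (w ^ j) (w ^ j)" for j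
    unfolding bnd_def using P_0 P_add[OF wk_mem wk_mem, of j j] by simp
  have A: "bnd (a - mp_const r * w ^ k) (mp_const \<delta> * w ^ k)"
    and B: "bnd (b - mp_const s * w ^ l) (mp_const \<delta> * w ^ l)"
    using assms d by (auto simp: st_def)
  have "bnd ((a - mp_const r * w ^ k) * (b - mp_const s * w ^ l)
       + (mp_const r * w ^ k) * (b - mp_const s * w ^ l) + (mp_const s * w ^ l) * (a - mp_const r * w ^ k))
     ((mp_const \<delta> * w ^ k) * (mp_const \<delta> * w ^ l) + (mp_const \<bar>r\<bar> * w ^ k) * (mp_const \<delta> * w ^ l)
       + (mp_const \<bar>s\<bar> * w ^ l) * (mp_const \<delta> * w ^ k))" (is "bnd ?x ?u")
    by (intro bnd_add bnd_mult A B W bnd_const order_refl)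
  moreover have "mp_const \<epsilon> * w ^ (k + l) - ?u \<in> P"
  proof -
    have "mp_const \<epsilon> * w ^ (k + l) - ?u = mp_const (\<epsilon> - (\<delta> * \<delta> + \<bar>r\<bar> * \<delta> + \<bar>s\<bar> * \<delta>)) * w ^ (k + l)"
      by (rule mp_eqI) (simp add: algebra_simps power_add)
    also have "\<dots> \<in> P" using ineq by (intro P_mult P_const wk_mem) auto
    finally show ?thesis .
  qed
  moreover have "?x = a * b - mp_const (r * s) * w ^ (k + l)"
    by (rule mp_eqI) (simp add: algebra_simps power_add)
  ultimately show "bnd (a * b - mp_const (r * s) * w ^ (k + l)) (mp_const \<epsilon> * w ^ (k + l))"
    using bnd_mono by metis
qed

lemma st_const: "st 0 (mp_const c) c"
  unfolding st_def bnd_def by (auto simp: P_const)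

lemma st_scale: "st k a r \<Longrightarrow> st k (mp_const c * a) (c * r)"
  using st_mult[OF st_const] by fastforce

lemma st_0: "st k 0 0"
  unfolding st_def bnd_def by (auto intro!: P_mult P_const wk_mem)

lemma st_diff: "st k a r \<Longrightarrow> st k b s \<Longrightarrow> st k (a - b) (r - s)"
  using st_add[OF _ st_scale[of k b s "-1"], of a r] by (simp add: mp_const_uminus)

lemma st_unique:
  assumes "st k a r" "st k a s"
  shows "r = s"
  using st_nonneg[OF st_diff[OF assms]] st_nonneg[OF st_diff[OF assms(2,1)]] P_0 by simp

lemma st_sum:
  assumes "\<And>i. i \<in> I \<Longrightarrow> st k (a i) (r i)"
  shows "st k (\<Sum>i\<in>I. a i) (\<Sum>i\<in>I. r i)"
  using assms by (induction I rule: infinite_finite_induct) (auto intro: st_add st_0)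

lemma st_one: "st 0 1 1"
  using st_const[of 1] by simp

lemma st_prod:
  assumes "\<And>i. i \<in> I \<Longrightarrow> st (k i) (a i) (r i)"
  shows "st (\<Sum>i\<in>I. k i) (\<Prod>i\<in>I. a i) (\<Prod>i\<in>I. r i)"
  using assms by (induction I rule: infinite_finite_induct) (auto intro: st_mult st_one)

lemma st_power: "st k a r \<Longrightarrow> st (k * j) (a ^ j) (r ^ j)"
  by (induction j) (auto intro: st_mult st_one)

lemma st_w: "st 1 w 1"
  unfolding st_def bnd_def by (auto intro!: P_mult P_const w_mem)

text \<open>An element whose power is bounded by the same power of \<open>w ^ k\<close> is bounded by a multiple of \<open>w ^ k\<close>.\<close>
lemma root_upper_bound:
  assumes D: "D > 0" and a: "mp_const v * (w ^ k) ^ D - a ^ D \<in> P" and C: "C \<ge> 1" "C > v"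
  shows "mp_const C * w ^ k - a \<in> P"
proof (rule ccontr)
  assume "mp_const C * w ^ k - a \<notin> P"
  then have "- (mp_const C * w ^ k - a) \<in> P" using total by blast
  then have "a - mp_const C * w ^ k \<in> P" by simp
  then have "a ^ D - (mp_const C * w ^ k) ^ D \<in> P"
    using C by (intro power_diff_mem P_mult P_const wk_mem) auto
  from P_add[OF this a] have "(a ^ D - (mp_const C * w ^ k) ^ D) + (mp_const v * (w ^ k) ^ D - a ^ D) \<in> P" .
  also have "(a ^ D - (mp_const C * w ^ k) ^ D) + (mp_const v * (w ^ k) ^ D - a ^ D)
      = mp_const (v - C ^ D) * w ^ (k * D)"
    by (rule mp_eqI) (simp add: left_diff_distrib power_mult_distrib power_mult)
  finally have "mp_const (v - C ^ D) * w ^ (k * D) \<in> P" .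
  then have "v \<ge> C ^ D" using neg_wk by fastforce
  moreover have "C ^ D \<ge> C ^ 1" using C D by (intro power_increasing) auto
  ultimately show False using C by simp
qed

lemma root_bnd:
  assumes D: "D > 0" "even D" and a: "mp_const v * (w ^ k) ^ D - a ^ D \<in> P"
  obtains C where "bnd a (mp_const C * w ^ k)"
proof -
  let ?C = "max 1 (v + 1)"
  have "mp_const ?C * w ^ k - a \<in> P" by (rule root_upper_bound[OF D(1) a]) auto
  moreover have "mp_const ?C * w ^ k - (- a) \<in> P"
    by (rule root_upper_bound[OF D(1)]) (use a D(2) in auto)
  ultimately show ?thesis using that by (auto simp: bnd_def)
qed

text \<open>No root of \<open>w\<close> is available, but standard parts of even powers determine those of their bases
  up to sign.\<close>
lemma st_root:
  assumes D: "D > 0" "even D" and a: "st D (a ^ D) v"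
  obtains r where "st 1 a r" "r ^ D = v"
proof -
  have "mp_const 1 * w ^ D - (a ^ D - mp_const v * w ^ D) \<in> P"
    using a[unfolded st_def, rule_format, of 1] by (simp add: bnd_def)
  then have "mp_const (v + 1) * (w ^ 1) ^ D - a ^ D \<in> P"
    by (simp add: mp_const_add algebra_simps)
  then obtain C where "bnd a (mp_const C * w ^ 1)" by (rule root_bnd[OF D])
  then obtain r where r: "st 1 a r" by (rule st_exists)
  then have "st D (a ^ D) (r ^ D)" using st_power[OF r, of D] by simp
  then have "r ^ D = v" using a by (rule st_unique)
  with r show ?thesis by (rule that)
qed

text \<open>If all variables are bounded by real numbers, their standard parts form a real point, and the
  standard part of any polynomial is its value at that point.\<close>
lemma bounded_point:
  assumes "\<And>i. \<exists>C. bnd (mp_var i) (mp_const C)"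
  obtains x where "\<And>p. st 0 p (mp_eval p x)"
proof -
  have "\<exists>r. st 0 (mp_var i) r" for i
    using assms[of i] st_exists[of "mp_var i" _ 0] by auto
  then obtain r where r: "\<And>i. st 0 (mp_var i) (r i)" by metis
  have "st 0 p (mp_eval p (\<chi> i. r i))" for p
  proof (induction p rule: mpoly_ring_induct)
    case (mult p q)
    then show ?case using st_mult[of 0 p _ 0 q] by simp
  qed (auto simp: st_const r intro: st_add)
  then show ?thesis by (rule that)
qed

end

text \<open>The weight of the monomial with exponents \<open>a\<close>, if the variable \<open>i\<close> has weight \<open>e i\<close>.\<close>
definition weight :: "('n::finite \<Rightarrow> nat) \<Rightarrow> ('n \<Rightarrow>\<^sub>0 nat) \<Rightarrow> nat" where
  "weight e a = (\<Sum>i\<in>UNIV. e i * Poly_Mapping.lookup a i)"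

text \<open>The part of weight \<open>D\<close> of a polynomial, as a function. It is the leading part when all
  monomials have weight at most \<open>D\<close>.\<close>
definition top_part :: "('n::finite \<Rightarrow> nat) \<Rightarrow> nat \<Rightarrow> 'n mpoly \<Rightarrow> real ^ 'n \<Rightarrow> real" where
  "top_part e D h x = (\<Sum>a | a \<in> Poly_Mapping.keys h \<and> weight e a = D. Poly_Mapping.lookup h a * mon_eval a x)"

text \<open>A polynomial is weighted definite of degree \<open>D\<close> if, with the weight \<open>e i\<close> for the variable \<open>i\<close>,
  all its monomials have weight at most \<open>D\<close> and its part of weight \<open>D\<close> is positive away from the
  origin. The \<open>d i\<close>-th power of the variable \<open>i\<close> has weight \<open>D\<close>; as \<open>d i\<close> is even, it is a square.\<close>
definition weighted_definite :: "('n::finite \<Rightarrow> nat) \<Rightarrow> ('n \<Rightarrow> nat) \<Rightarrow> nat \<Rightarrow> 'n mpoly \<Rightarrow> bool" where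
  "weighted_definite e d D h \<longleftrightarrow> D > 0 \<and> (\<forall>i. d i * e i = D \<and> even (d i)) \<and>
     (\<forall>a\<in>Poly_Mapping.keys h. weight e a \<le> D) \<and> (\<forall>x. x \<noteq> 0 \<longrightarrow> top_part e D h x > 0)"

text \<open>In an ordering with \<open>h \<le> c\<close> the sum of the powers \<open>x i ^ d i\<close> is bounded. Otherwise let \<open>w\<close> be one
  more than this sum. The standard parts of the quotients \<open>x i ^ d i / w\<close> and the signs of the
  variables define a point \<open>z \<noteq> 0\<close> such that \<open>h / w\<close> has the standard part \<open>top_part e D h z > 0\<close>,
  whereas \<open>c / w\<close> is infinitesimal.\<close>
lemma (in ordered_mpoly) weighted_definite_bounded:
  assumes wd: "weighted_definite e d D h" and c: "mp_const c - h \<in> P"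
  shows "\<exists>C. mp_const C - (1 + (\<Sum>i\<in>UNIV. mp_var i ^ d i)) \<in> P"
proof (rule ccontr)
  define w :: "'n mpoly" where "w = 1 + (\<Sum>i\<in>UNIV. mp_var i ^ d i)"
  assume "\<nexists>C. mp_const C - (1 + (\<Sum>i\<in>UNIV. mp_var i ^ d i)) \<in> P"
  then have notbd: "mp_const C - w \<notin> P" for C by (simp add: w_def)
  have inf: "w - mp_const C \<in> P" for C
    using notbd[of C] total[of "mp_const C - w"] by simp
  have D: "D > 0" and de: "\<And>i. d i * e i = D" and ev: "\<And>i. even (d i)"
    and wt: "\<And>a. a \<in> Poly_Mapping.keys h \<Longrightarrow> weight e a \<le> D"
    and pd: "\<And>x. x \<noteq> 0 \<Longrightarrow> top_part e D h x > 0"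
    using wd by (auto simp: weighted_definite_def)
  have dpos: "d i > 0" for i using de[of i] D by (metis gr0I mult_0)
  have evD: "even D" using de ev by (metis even_mult_iff)
  have powd: "mp_var i ^ d i \<in> P" for i
    using ev[of i] P_square by (metis evenE power_mult mult.commute)
  interpret ordered_mpoly_scale P w
    by unfold_locales (simp add: w_def P_sum powd)
  \<comment> \<open>The element \<open>w\<close> is infinitely large, so \<open>1 / w ^ j\<close> is infinitesimal.\<close>
  have st1: "st j 1 0" if "j > 0" for j
    unfolding st_def
  proof (intro allI impI)
    fix \<epsilon> :: real assume e: "\<epsilon> > 0"
    have "w * (w ^ (j - 1) - 1) + (w - mp_const (1 / \<epsilon>)) \<in> P" by (intro P_add P_mult inf w_mem wk1)
    also have "w * (w ^ (j - 1) - 1) + (w - mp_const (1 / \<epsilon>)) = w ^ j - mp_const (1 / \<epsilon>)"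
      using that by (cases j) (auto simp: algebra_simps)
    finally have "mp_const \<epsilon> * (w ^ j - mp_const (1 / \<epsilon>)) \<in> P" using e by (intro P_mult P_const) auto
    also have "mp_const \<epsilon> * (w ^ j - mp_const (1 / \<epsilon>)) = mp_const \<epsilon> * w ^ j - 1"
      by (rule mp_eqI) (use e in \<open>simp add: algebra_simps\<close>)
    finally have "mp_const \<epsilon> * w ^ j - 1 \<in> P" .
    moreover have "mp_const \<epsilon> * w ^ j + 1 \<in> P" using e by (intro P_add P_mult P_const wk_mem P_1) auto
    ultimately show "bnd (1 - mp_const 0 * w ^ j) (mp_const \<epsilon> * w ^ j)" by (simp add: bnd_def)
  qed
  have lift: "st D a (if k = D then r else 0)" if "st k a r" "k \<le> D" for k a r
    using st_mult[OF that(1) st1[of "D - k"]] that by (cases "k = D") auto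
  have "\<exists>s. st 1 (mp_var i ^ d i) s" for i
  proof -
    have "w - mp_var i ^ d i = 1 + (\<Sum>j\<in>UNIV - {i}. mp_var j ^ d j)"
      by (simp add: w_def sum.remove[of UNIV i])
    also have "\<dots> \<in> P" by (intro P_add P_1 P_sum powd)
    finally have "bnd (mp_var i ^ d i) (mp_const 1 * w ^ 1)"
      using P_add[OF w_mem powd] by (simp add: bnd_def)
    then show ?thesis using st_exists by blast
  qed
  then obtain s where s: "\<And>i. st 1 (mp_var i ^ d i) (s i)" by metis
  have s0: "s i \<ge> 0" for i using st_nonneg[OF s powd] .
  have "st 1 (1 + (\<Sum>i\<in>UNIV. mp_var i ^ d i)) (0 + (\<Sum>i\<in>UNIV. s i))"
    by (intro st_add st_sum s st1) auto
  then have "st 1 w (0 + (\<Sum>i\<in>UNIV. s i))" unfolding w_def[symmetric] .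
  then have ssum: "(\<Sum>i\<in>UNIV. s i) = 1" using st_unique[OF _ st_w] by simp
  define sg :: "'n \<Rightarrow> real" where "sg i = (if mp_var i \<in> P then 1 else - 1)" for i
  have sgP: "mp_const (sg i) * mp_var i \<in> P" for i
    using total[of "mp_var i"] by (auto simp: sg_def mp_const_uminus)
  define \<rho> where "\<rho> i = root (d i) (s i)" for i
  have \<rho>: "\<rho> i \<ge> 0" "\<rho> i ^ d i = s i" for i
    using s0[of i] dpos[of i] by (auto simp: \<rho>_def)
  define z :: "real ^ 'n" where "z = (\<chi> i. sg i * \<rho> i)"
  \<comment> \<open>The \<open>D\<close>-th power of a monomial is a monomial in the powers \<open>x i ^ d i\<close>, whose standard parts
    are known; the sign comes from the signs of the variables.\<close>
  have mon: "st 1 (\<Prod>i\<in>UNIV. mp_var i ^ Poly_Mapping.lookup a i) (if weight e a = D then mon_eval a z else 0)"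
    if a: "weight e a \<le> D" for a
  proof -
    let ?m = "\<Prod>i\<in>UNIV. mp_var i ^ Poly_Mapping.lookup a i :: 'n mpoly"
    let ?\<rho> = "\<Prod>i\<in>UNIV. \<rho> i ^ Poly_Mapping.lookup a i"
    have exponent: "d i * (e i * j) = j * D" for i j
      using de[of i] by (metis mult.assoc mult.commute)
    have "st (\<Sum>i\<in>UNIV. 1 * (e i * Poly_Mapping.lookup a i))
        (\<Prod>i\<in>UNIV. (mp_var i ^ d i) ^ (e i * Poly_Mapping.lookup a i))
        (\<Prod>i\<in>UNIV. s i ^ (e i * Poly_Mapping.lookup a i))"
      by (intro st_prod st_power s)
    also have "(\<Prod>i\<in>UNIV. (mp_var i ^ d i) ^ (e i * Poly_Mapping.lookup a i)) = ?m ^ D"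
      unfolding prod_power_distrib
      by (rule prod.cong) (simp_all add: exponent flip: power_mult)
    also have "(\<Prod>i\<in>UNIV. s i ^ (e i * Poly_Mapping.lookup a i)) = ?\<rho> ^ D"
      unfolding prod_power_distrib
      by (rule prod.cong) (simp_all add: exponent flip: power_mult \<rho>(2))
    also have "(\<Sum>i\<in>UNIV. 1 * (e i * Poly_Mapping.lookup a i)) = weight e a" by (simp add: weight_def)
    finally have "st D (?m ^ D) (if weight e a = D then ?\<rho> ^ D else 0)" using a by (rule lift)
    then obtain r where r: "st 1 ?m r" "r ^ D = (if weight e a = D then ?\<rho> ^ D else 0)"
      by (rule st_root[OF D evD])
    have "r = (if weight e a = D then mon_eval a z else 0)"
    proof (cases "weight e a = D")
      case True
      define \<sigma> where "\<sigma> = (\<Prod>i\<in>UNIV. sg i ^ Poly_Mapping.lookup a i)"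
      have "\<bar>sg i\<bar> = 1" for i by (simp add: sg_def)
      then have \<sigma>: "\<bar>\<sigma>\<bar> = 1" by (simp add: \<sigma>_def abs_prod power_abs)
      then have \<sigma>2: "\<sigma> * \<sigma> = 1" by (metis abs_mult_self_eq mult_1)
      have \<sigma>D: "\<sigma> ^ D = 1" using \<sigma> evD by (metis power_even_abs power_one)
      have "st 1 (mp_const \<sigma> * ?m) (\<sigma> * r)" by (rule st_scale[OF r(1)])
      moreover have "mp_const \<sigma> * ?m = (\<Prod>i\<in>UNIV. (mp_const (sg i) * mp_var i) ^ Poly_Mapping.lookup a i)"
        by (rule mp_eqI) (simp add: \<sigma>_def power_mult_distrib prod.distrib)
      moreover have "\<dots> \<in> P" by (intro P_prod P_power sgP)
      ultimately have "\<sigma> * r \<ge> 0" using st_nonneg by metis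
      moreover have "(\<sigma> * r) ^ D = ?\<rho> ^ D" using r(2) True \<sigma>D by (simp add: power_mult_distrib)
      moreover have "?\<rho> \<ge> 0" by (intro prod_nonneg zero_le_power \<rho>)
      ultimately have "\<sigma> * r = ?\<rho>" using power_eq_iff_eq_base[OF D] by blast
      then have "r = \<sigma> * ?\<rho>" using \<sigma>2 by (metis mult.assoc mult_1)
      also have "\<dots> = mon_eval a z"
        by (simp add: mon_eval_def z_def \<sigma>_def power_mult_distrib prod.distrib)
      finally show ?thesis using True by simp
    next
      case False
      then show ?thesis using r(2) D by simp
    qed
    with r(1) show ?thesis by simp
  qed
  have "st 1 (\<Sum>a\<in>Poly_Mapping.keys h. mp_const (Poly_Mapping.lookup h a) *
          (\<Prod>i\<in>UNIV. mp_var i ^ Poly_Mapping.lookup a i))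
     (\<Sum>a\<in>Poly_Mapping.keys h. Poly_Mapping.lookup h a * (if weight e a = D then mon_eval a z else 0))"
    by (intro st_sum st_scale mon wt)
  also have "(\<Sum>a\<in>Poly_Mapping.keys h. Poly_Mapping.lookup h a * (if weight e a = D then mon_eval a z else 0))
      = top_part e D h z"
    unfolding top_part_def sum.inter_filter[OF finite_keys] by (rule sum.cong) auto
  finally have "st 1 h (top_part e D h z)" by (simp flip: mpoly_expand)
  moreover have "st 1 (mp_const c) 0" using st_scale[OF st1[of 1], of c] by simp
  ultimately have "st 1 (mp_const c - h) (0 - top_part e D h z)" by (intro st_diff)
  then have "top_part e D h z \<le> 0" using st_nonneg[OF _ c] by force
  moreover have "z \<noteq> 0"
  proof
    assume "z = 0"
    then have "sg i * \<rho> i = 0" for i by (simp add: z_def vec_eq_iff)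
    then have "\<rho> i = 0" for i by (metis mult_eq_0_iff neg_equal_0_iff_equal sg_def zero_neq_one)
    then have "s i = 0" for i using \<rho>(2)[of i] dpos[of i] by (metis zero_power)
    then show False using ssum by simp
  qed
  ultimately show False using pd[of z] by simp
qed

text \<open>Positivity on the real sublevel set carries over to all orderings with \<open>h \<le> c\<close>. For a general \<open>h\<close>
  this would need a transfer principle; for weighted definite \<open>h\<close> the standard part is enough.\<close>
theorem weighted_definite_positive:
  assumes wd: "weighted_definite e d D h" and P: "ring_ordering P" and c: "mp_const c - h \<in> P"
    and pos: "\<And>x. mp_eval h x \<le> c \<Longrightarrow> mp_eval p x > 0"
  shows "- p \<notin> P"
proof
  assume p: "- p \<in> P"
  interpret ordered_mpoly_scale P 1
    using P by unfold_locales (auto simp: ring_ordering_def intro: preordering_0)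
  obtain C where C: "mp_const C - (1 + (\<Sum>i\<in>UNIV. mp_var i ^ d i)) \<in> P"
    using weighted_definite_bounded[OF wd c] by blast
  have ev: "even (d i)" and dpos: "d i > 0" for i
    using wd unfolding weighted_definite_def by (auto intro!: gr0I) (metis mult_0 less_irrefl)
  have powd: "mp_var i ^ d i \<in> P" for i
    using ev[of i] P_square by (metis evenE power_mult mult.commute)
  have "\<exists>C'. bnd (mp_var i) (mp_const C')" for i
  proof -
    have "mp_const C - (1 + (\<Sum>i\<in>UNIV. mp_var i ^ d i)) + (1 + (\<Sum>j\<in>UNIV - {i}. mp_var j ^ d j)) \<in> P"
      by (intro P_add C P_1 P_sum powd)
    also have "mp_const C - (1 + (\<Sum>i\<in>UNIV. mp_var i ^ d i)) + (1 + (\<Sum>j\<in>UNIV - {i}. mp_var j ^ d j))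
      = mp_const C * (1 ^ 0) ^ d i - mp_var i ^ d i"
      by (simp add: sum.remove[of UNIV i])
    finally show ?thesis using root_bnd[OF dpos ev, of C 0] by (metis mult.right_neutral power_one)
  qed
  then obtain x where x: "\<And>q. st 0 q (mp_eval q x)" using bounded_point by blast
  have "mp_eval h x \<le> c" using st_nonneg[OF x c] by simp
  then show False using pos[of x] st_nonneg[OF x p] by simp
qed

section \<open>Growth of univariate polynomials\<close>

lemma poly_growth:
  fixes q :: "real poly"
  obtains C where "C \<ge> 0" "\<And>t. \<bar>poly q t\<bar> \<le> C * max 1 \<bar>t\<bar> ^ degree q"
proof
  let ?C = "\<Sum>i\<le>degree q. \<bar>coeff q i\<bar>"
  show "?C \<ge> 0" by (simp add: sum_nonneg)
  fix t
  have "\<bar>poly q t\<bar> \<le> (\<Sum>i\<le>degree q. \<bar>coeff q i * t ^ i\<bar>)"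
    unfolding poly_altdef by (rule sum_abs)
  also have "\<dots> \<le> (\<Sum>i\<le>degree q. \<bar>coeff q i\<bar> * max 1 \<bar>t\<bar> ^ degree q)"
  proof (rule sum_mono)
    fix i assume i: "i \<in> {..degree q}"
    have "\<bar>t\<bar> ^ i \<le> max 1 \<bar>t\<bar> ^ i" by (intro power_mono) auto
    also have "\<dots> \<le> max 1 \<bar>t\<bar> ^ degree q" using i by (intro power_increasing) auto
    finally show "\<bar>coeff q i * t ^ i\<bar> \<le> \<bar>coeff q i\<bar> * max 1 \<bar>t\<bar> ^ degree q"
      by (simp add: abs_mult power_abs mult_left_mono)
  qed
  also have "\<dots> = ?C * max 1 \<bar>t\<bar> ^ degree q" by (simp add: sum_distrib_right)
  finally show "\<bar>poly q t\<bar> \<le> ?C * max 1 \<bar>t\<bar> ^ degree q" .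
qed

lemma poly_unbounded_above:
  fixes q :: "real poly"
  assumes "degree q > 0" "lead_coeff q > 0"
  obtains t where "t \<ge> 1" "poly q t > M"
proof -
  have deg: "degree (q + [:- M:]) = degree q" using assms(1) by (intro degree_add_eq_left) simp
  have lc: "lead_coeff (q + [:- M:]) = lead_coeff q"
    unfolding deg using assms(1) by (cases "degree q") auto
  then obtain n where n: "\<And>t. t \<ge> n \<Longrightarrow> poly (q + [:- M:]) t \<ge> lead_coeff q"
    using poly_pinfty_gt_lc[of "q + [:- M:]"] assms(2) by auto
  have "poly q (max 1 n) > M" using n[of "max 1 n"] assms(2) by simp
  then show ?thesis using that[of "max 1 n"] by simp
qed

lemma degree_le_of_bound:
  fixes q :: "real poly"
  assumes "\<And>t. t \<ge> 1 \<Longrightarrow> \<bar>poly q t\<bar> \<le> C * t ^ D"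
  shows "degree q \<le> D"
proof (rule ccontr)
  assume D: "\<not> degree q \<le> D"
  have False if r: "degree r > D" "lead_coeff r > 0" "\<And>t. t \<ge> 1 \<Longrightarrow> poly r t \<le> C * t ^ D" for r
  proof -
    have deg: "degree (r + monom (- C) D) = degree r"
      using r(1) degree_monom_le[of "- C" D] by (intro degree_add_eq_left) linarith
    have lc: "lead_coeff (r + monom (- C) D) = lead_coeff r" unfolding deg using r(1) by simp
    obtain t where "t \<ge> 1" "poly (r + monom (- C) D) t > 0"
      by (rule poly_unbounded_above[of "r + monom (- C) D" 0]) (use r(1,2) deg lc in auto)
    then show False using r(3)[of t] by (simp add: poly_monom)
  qed
  from this[of q] this[of "- q"] show False
    using D assms by (cases "lead_coeff q > 0") (force simp: abs_le_iff lead_coeff_minus dest: assms)+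
qed

lemma coeff_nonneg_of_lower_bound:
  fixes q :: "real poly"
  assumes "degree q \<le> D" "D > 0" "\<And>t. t \<ge> 1 \<Longrightarrow> B \<le> poly q t"
  shows "coeff q D \<ge> 0"
proof (rule ccontr)
  assume neg: "\<not> coeff q D \<ge> 0"
  then have "degree q = D" using assms(1) le_degree[of q D] by auto
  then obtain t where "t \<ge> 1" "poly (- q) t > - B"
    using poly_unbounded_above[of "- q" "- B"] neg assms(2) by auto
  then show False using assms(3)[of t] by simp
qed

lemma even_degree_of_lower_bound:
  fixes q :: "real poly"
  assumes "\<And>t. B \<le> poly q t"
  shows "even (degree q)"
proof (rule ccontr)
  assume odd: "odd (degree q)"
  then have pos: "degree q > 0" by (cases "degree q") auto
  let ?r = "pcompose q [:0, - 1:]"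
  have r1: "degree ?r = degree q" by (simp add: degree_pcompose)
  have r: "lead_coeff ?r = - lead_coeff q"
    using odd lead_coeff_comp[of "[:0, - 1:]" q] by simp
  have "coeff q (degree q) \<ge> 0"
    by (rule coeff_nonneg_of_lower_bound[OF order_refl pos assms])
  moreover have "coeff ?r (degree ?r) \<ge> 0"
    by (rule coeff_nonneg_of_lower_bound[of _ _ B]) (use pos r1 assms in \<open>auto simp: poly_pcompose\<close>)
  ultimately have "lead_coeff q = 0" using r by simp
  then show False using pos by auto
qed

section \<open>Adapted bases of a convex polynomial\<close>

text \<open>The restriction of a polynomial to the line through the origin in the direction \<open>u\<close>, as a
  polynomial in the line parameter. It exists and is unique.\<close>
definition line_poly :: "'n::finite mpoly \<Rightarrow> real ^ 'n \<Rightarrow> real poly" where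
  "line_poly h u = (SOME r. \<forall>t. mp_eval h (t *\<^sub>R u) = poly r t)"

text \<open>The degree of growth in a given direction.\<close>
definition line_degree :: "'n::finite mpoly \<Rightarrow> real ^ 'n \<Rightarrow> nat" where
  "line_degree h u = degree (line_poly h u)"

lemma poly_line_poly: "poly (line_poly h u) t = mp_eval h (t *\<^sub>R u)"
proof -
  obtain r where "\<And>t. mp_eval h (0 + t *\<^sub>R u) = poly r t" using mp_eval_line by blast
  then have "\<forall>t. mp_eval h (t *\<^sub>R u) = poly r t" by simp
  then show ?thesis unfolding line_poly_def by (rule someI2) simp
qed

lemma line_poly_unique: "(\<And>t. mp_eval h (t *\<^sub>R u) = poly r t) \<Longrightarrow> line_poly h u = r"
  by (subst poly_eq_poly_eq_iff[symmetric]) (simp add: fun_eq_iff poly_line_poly)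

text \<open>The weighted scaling by \<open>\<tau>\<close>: the coordinate \<open>i\<close> is multiplied by \<open>\<tau> ^ e i\<close>.\<close>
definition scaling :: "('n::finite \<Rightarrow> nat) \<Rightarrow> real \<Rightarrow> real ^ 'n \<Rightarrow> real ^ 'n" where
  "scaling e \<tau> z = (\<chi> i. \<tau> ^ e i * z $ i)"

text \<open>The values of \<open>h\<close> on the orbit of \<open>z\<close> under weighted scalings, as a polynomial in \<open>\<tau>\<close>.\<close>
definition scaling_poly :: "('n::finite \<Rightarrow> nat) \<Rightarrow> 'n mpoly \<Rightarrow> real ^ 'n \<Rightarrow> real poly" where
  "scaling_poly e h z = (\<Sum>a\<in>Poly_Mapping.keys h. monom (Poly_Mapping.lookup h a * mon_eval a z) (weight e a))"

lemma mon_eval_scaling: "mon_eval a (scaling e \<tau> z) = \<tau> ^ weight e a * mon_eval a z"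
  by (simp add: mon_eval_def scaling_def weight_def power_mult_distrib prod.distrib power_sum power_mult)

lemma poly_scaling_poly: "poly (scaling_poly e h z) \<tau> = mp_eval h (scaling e \<tau> z)"
  by (simp add: scaling_poly_def mp_eval_keys poly_sum poly_monom mon_eval_scaling mult_ac)

lemma coeff_scaling_poly: "coeff (scaling_poly e h z) k = top_part e k h z"
  unfolding scaling_poly_def coeff_sum top_part_def sum.inter_filter[OF finite_keys]
  by (rule sum.cong) auto

lemma top_part_scaling: "top_part e D h (scaling e \<tau> z) = \<tau> ^ D * top_part e D h z"
  by (auto simp: top_part_def mon_eval_scaling sum_distrib_left mult_ac intro!: sum.cong)

lemma continuous_mon_eval: "continuous_on S (mon_eval a)"
  unfolding mon_eval_def by (intro continuous_intros)

lemma continuous_top_part: "continuous_on S (top_part e D h)"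
  unfolding top_part_def by (intro continuous_intros continuous_mon_eval)

lemma scaling_scaleR: "scaling e \<tau> (s *\<^sub>R z) = s *\<^sub>R scaling e \<tau> z"
  by (simp add: scaling_def vec_eq_iff)

text \<open>Along the coordinate axes the polynomial grows with the degrees \<open>d i\<close>. By convexity (Jensen's
  inequality for the coordinate axes) the weights \<open>D / d i\<close> bound its growth in all directions.\<close>
lemma convex_scaling_bound:
  fixes h :: "'n::finite mpoly"
  assumes conv: "convex_on UNIV (mp_eval h)"
    and de: "\<And>i. line_degree h (axis i 1) * e i = D"
  obtains C where "\<And>\<tau>. \<tau> \<ge> 1 \<Longrightarrow> mp_eval h (scaling e \<tau> z) \<le> C * \<tau> ^ D"
proof -
  define N where "N = real CARD('n)"
  have N: "N > 0" by (simp add: N_def)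
  have "\<exists>C. C \<ge> 0 \<and> (\<forall>t. \<bar>poly (line_poly h (axis i 1)) t\<bar> \<le> C * max 1 \<bar>t\<bar> ^ line_degree h (axis i 1))" for i
    using poly_growth[of "line_poly h (axis i 1)"] unfolding line_degree_def by metis
  then obtain C where C: "\<And>i. C i \<ge> 0"
    "\<And>i t. \<bar>poly (line_poly h (axis i 1)) t\<bar> \<le> C i * max 1 \<bar>t\<bar> ^ line_degree h (axis i 1)" by metis
  define K where "K = (\<Sum>i\<in>UNIV. 1 / N * (C i * (max 1 (N * \<bar>z $ i\<bar>)) ^ line_degree h (axis i 1)))"
  have "mp_eval h (scaling e \<tau> z) \<le> K * \<tau> ^ D" if \<tau>: "\<tau> \<ge> 1" for \<tau>
  proof -
    let ?y = "\<lambda>i. (N * (\<tau> ^ e i * z $ i)) *\<^sub>R (axis i 1 :: real ^ 'n)"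
    have "scaling e \<tau> z = (\<Sum>i\<in>UNIV. (1 / N) *\<^sub>R ?y i)"
      using N by (simp add: vec_eq_iff scaling_def axis_def if_distrib cong: if_cong)
    also have "mp_eval h \<dots> \<le> (\<Sum>i\<in>UNIV. 1 / N * mp_eval h (?y i))"
      by (rule convex_on_sum[OF _ _ conv]) (use N in \<open>auto simp: N_def\<close>)
    also have "\<dots> \<le> (\<Sum>i\<in>UNIV. 1 / N * (C i * (max 1 (N * \<bar>z $ i\<bar>)) ^ line_degree h (axis i 1)) * \<tau> ^ D)"
    proof (rule sum_mono)
      fix i
      let ?d = "line_degree h (axis i 1)"
      have "mp_eval h (?y i) \<le> C i * max 1 \<bar>N * (\<tau> ^ e i * z $ i)\<bar> ^ ?d"
        using C(2)[of i "N * (\<tau> ^ e i * z $ i)"] by (simp add: poly_line_poly abs_le_iff)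
      also have "\<dots> \<le> C i * (max 1 (N * \<bar>z $ i\<bar>) * \<tau> ^ e i) ^ ?d"
      proof (intro mult_left_mono power_mono C)
        have t1: "\<tau> ^ e i \<ge> 1" using \<tau> by simp
        have "1 * 1 \<le> max 1 (N * \<bar>z $ i\<bar>) * \<tau> ^ e i" using t1 by (intro mult_mono) auto
        moreover have "\<bar>N * (\<tau> ^ e i * z $ i)\<bar> = N * \<bar>z $ i\<bar> * \<tau> ^ e i"
          using N \<tau> by (simp add: abs_mult)
        moreover have "\<dots> \<le> max 1 (N * \<bar>z $ i\<bar>) * \<tau> ^ e i" using t1 by (intro mult_right_mono) auto
        ultimately show "max 1 \<bar>N * (\<tau> ^ e i * z $ i)\<bar> \<le> max 1 (N * \<bar>z $ i\<bar>) * \<tau> ^ e i" by simp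
      qed auto
      also have "\<dots> = C i * max 1 (N * \<bar>z $ i\<bar>) ^ ?d * \<tau> ^ D"
        using de[of i] by (simp add: power_mult_distrib mult.commute flip: power_mult)
      finally have "mp_eval h (?y i) \<le> C i * max 1 (N * \<bar>z $ i\<bar>) ^ ?d * \<tau> ^ D" .
      then show "1 / N * mp_eval h (?y i) \<le> 1 / N * (C i * max 1 (N * \<bar>z $ i\<bar>) ^ ?d) * \<tau> ^ D"
        using N by (simp add: divide_right_mono)
    qed
    also have "\<dots> = K * \<tau> ^ D" by (simp add: K_def sum_distrib_right)
    finally show ?thesis .
  qed
  then show ?thesis by (rule that)
qed

text \<open>A convex polynomial is weighted definite in adapted coordinates, with weights inverse to the line
  degrees of the axes. If its leading part \<open>H \<ge> 0\<close> had a zero \<open>z \<noteq> 0\<close>, then \<open>H\<close> would vanish on the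
  orbit of \<open>z\<close> under weighted scalings and, by convexity, on the segments from the origin to the
  orbit. In the limit it would vanish at the point \<open>z'\<close> that keeps only the coordinates of largest
  weight. These all have the same line degree \<open>D / E\<close>, so the line degree of \<open>z'\<close> would be less than
  \<open>D / E\<close>, which the adapted coordinates exclude.\<close>
theorem weighted_definite_of_adapted:
  fixes h :: "'n::finite mpoly"
  assumes conv: "convex_on UNIV (mp_eval h)" and lower: "\<And>x. B \<le> mp_eval h x"
    and nonconst: "\<And>i. line_degree h (axis i 1) > 0"
    and adapted: "\<And>y i. y $ i \<noteq> 0 \<Longrightarrow> line_degree h (axis i 1) \<le> line_degree h y"
  shows "\<exists>e d D. weighted_definite e d D h"
proof -
  define d where "d i = line_degree h (axis i 1)" for i
  \<comment> \<open>Any common multiple of the degrees would do; it makes the weights \<open>D / d i\<close> integral.\<close>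
  define D where "D = (\<Prod>i\<in>UNIV. d i)"
  define e where "e i = (\<Prod>j\<in>UNIV - {i}. d j)" for i
  have dpos: "d i > 0" for i using nonconst by (simp add: d_def)
  have D: "D > 0" using dpos by (simp add: D_def prod_pos)
  have de: "d i * e i = D" for i by (simp add: D_def e_def prod.remove[of UNIV i])
  have epos: "e i > 0" for i using de[of i] D by (metis gr0I mult_0_right)
  have ev: "even (d i)" for i
    unfolding d_def line_degree_def
    by (rule even_degree_of_lower_bound[of B]) (simp add: poly_line_poly lower)
  have degree_le: "degree (scaling_poly e h z) \<le> D" for z
  proof -
    obtain C where C: "\<And>\<tau>. \<tau> \<ge> 1 \<Longrightarrow> mp_eval h (scaling e \<tau> z) \<le> C * \<tau> ^ D"
      by (rule convex_scaling_bound[OF conv, of e D z]) (use de in \<open>auto simp: d_def\<close>)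
    show ?thesis
    proof (rule degree_le_of_bound[where C = "\<bar>B\<bar> + \<bar>C\<bar>"])
      fix \<tau> :: real assume \<tau>: "\<tau> \<ge> 1"
      have t1: "\<tau> ^ D \<ge> 1" using \<tau> by simp
      have "\<bar>B\<bar> * 1 \<le> \<bar>B\<bar> * \<tau> ^ D" using t1 by (intro mult_left_mono) auto
      moreover have "C * \<tau> ^ D \<le> \<bar>C\<bar> * \<tau> ^ D" using t1 by (intro mult_right_mono) auto
      moreover have "0 \<le> \<bar>C\<bar> * \<tau> ^ D" "0 \<le> \<bar>B\<bar> * \<tau> ^ D" using \<tau> by simp_all
      ultimately show "\<bar>poly (scaling_poly e h z) \<tau>\<bar> \<le> (\<bar>B\<bar> + \<bar>C\<bar>) * \<tau> ^ D"
        using C[OF \<tau>] lower[of "scaling e \<tau> z"] by (simp add: poly_scaling_poly distrib_right abs_le_iff)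
    qed
  qed
  have wt: "weight e a \<le> D" if a: "a \<in> Poly_Mapping.keys h" for a
  proof (rule ccontr)
    assume "\<not> weight e a \<le> D"
    then have "coeff (scaling_poly e h z) (weight e a) = 0" for z
      using degree_le[of z] by (intro coeff_eq_0) linarith
    then have "(\<Sum>b | b \<in> Poly_Mapping.keys h \<and> weight e b = weight e a. Poly_Mapping.lookup h b * mon_eval b z) = 0" for z
      by (simp add: coeff_scaling_poly top_part_def)
    then have "Poly_Mapping.lookup h a = 0"
      by (rule mon_combination_eq_0[rotated]) (use a in auto)
    then show False using a by (simp add: in_keys_iff)
  qed
  have H0: "top_part e D h z \<ge> 0" for z
    using coeff_nonneg_of_lower_bound[OF degree_le D, of B z] lower
    by (simp add: coeff_scaling_poly poly_scaling_poly)
  \<comment> \<open>\<open>H\<close> inherits convexity from \<open>h\<close>; only the comparison with the origin is needed.\<close>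
  have Hstar: "top_part e D h (s *\<^sub>R z) \<le> s * top_part e D h z" if s: "0 \<le> s" "s \<le> 1" for s z
  proof -
    let ?q = "smult s (scaling_poly e h z) - scaling_poly e h (s *\<^sub>R z)"
    have "coeff ?q D \<ge> 0"
    proof (rule coeff_nonneg_of_lower_bound[OF _ D])
      show "degree ?q \<le> D" by (intro degree_diff_le order.trans[OF degree_smult_le] degree_le)
      fix \<tau> :: real
      have "mp_eval h ((1 - s) *\<^sub>R 0 + s *\<^sub>R scaling e \<tau> z) \<le> (1 - s) * mp_eval h 0 + s * mp_eval h (scaling e \<tau> z)"
        using convex_onD[OF conv s] by blast
      then show "- (1 - s) * mp_eval h 0 \<le> poly ?q \<tau>"
        by (simp add: poly_scaling_poly scaling_scaleR algebra_simps)
    qed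
    then show ?thesis by (simp add: coeff_scaling_poly)
  qed
  have pd: "top_part e D h z > 0" if z: "z \<noteq> 0" for z
  proof (rule ccontr)
    assume "\<not> top_part e D h z > 0"
    then have Hz: "top_part e D h z = 0" using H0[of z] by simp
    define E where "E = Max (e ` {i. z $ i \<noteq> 0})"
    have "{i. z $ i \<noteq> 0} \<noteq> {}" using z by (auto simp: vec_eq_iff)
    then have Emem: "E \<in> e ` {i. z $ i \<noteq> 0}" and Emax: "\<And>i. z $ i \<noteq> 0 \<Longrightarrow> e i \<le> E"
      unfolding E_def by (auto intro: Max_in)
    then obtain j where j: "z $ j \<noteq> 0" "e j = E" by auto
    define z' where "z' = (\<chi> i. if e i = E then z $ i else 0)"
    define y where "y k = scaling e (real (Suc k)) z" for k
    define s where "s k = inverse (real (Suc k)) ^ E" for k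
    have s01: "0 \<le> s k" "s k \<le> 1" for k
      unfolding s_def by (auto intro!: power_le_one simp: field_simps)
    have "top_part e D h (s k *\<^sub>R y k) \<le> 0" for k
      using Hstar[OF s01, of k "y k"] by (simp add: y_def top_part_scaling Hz)
    then have zero: "top_part e D h (s k *\<^sub>R y k) = 0" for k using H0[of "s k *\<^sub>R y k"] by (intro antisym) auto
    have "(\<lambda>k. s k *\<^sub>R y k) \<longlonglongrightarrow> z'"
    proof (rule vec_tendstoI)
      fix i
      have comp: "(s k *\<^sub>R y k) $ i = inverse (real (Suc k)) ^ (E - e i) * z $ i" if "e i \<le> E" for k
      proof -
        have "inverse (real (Suc k)) ^ E = inverse (real (Suc k)) ^ (E - e i) * inverse (real (Suc k)) ^ e i"
          using that by (simp flip: power_add del: of_nat_Suc)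
        then show ?thesis
          by (simp add: s_def y_def scaling_def power_inverse del: of_nat_Suc)
      qed
      show "(\<lambda>k. (s k *\<^sub>R y k) $ i) \<longlonglongrightarrow> z' $ i"
      proof (cases "z $ i = 0")
        case True
        then show ?thesis by (simp add: y_def scaling_def z'_def)
      next
        case False
        then have le: "e i \<le> E" by (rule Emax)
        show ?thesis
        proof (cases "e i = E")
          case True
          then show ?thesis unfolding comp[OF le] by (simp add: z'_def)
        next
          case False
          have "(\<lambda>k. inverse (real (Suc k)) ^ (E - e i) * z $ i) \<longlonglongrightarrow> 0 ^ (E - e i) * z $ i"
            by (intro tendsto_intros LIMSEQ_inverse_real_of_nat)
          moreover have "(0::real) ^ (E - e i) = 0" using False le by simp
          ultimately show ?thesis unfolding comp[OF le] using False by (simp add: z'_def)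
        qed
      qed
    qed
    then have "(\<lambda>k. top_part e D h (s k *\<^sub>R y k)) \<longlonglongrightarrow> top_part e D h z'"
      by (rule continuous_on_tendsto_compose[OF continuous_top_part[of UNIV]]) auto
    then have Hz': "top_part e D h z' = 0" by (simp add: zero LIMSEQ_const_iff)
    have "scaling e \<tau> z' = \<tau> ^ E *\<^sub>R z'" for \<tau> by (auto simp: scaling_def z'_def vec_eq_iff)
    then have "scaling_poly e h z' = pcompose (line_poly h z') (monom 1 E)"
      by (subst poly_eq_poly_eq_iff[symmetric])
         (simp add: fun_eq_iff poly_pcompose poly_scaling_poly poly_line_poly poly_monom)
    then have "degree (scaling_poly e h z') = line_degree h z' * E"
      by (simp add: degree_pcompose degree_monom_eq line_degree_def)
    moreover have "line_degree h z' \<ge> d j"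
      unfolding d_def using adapted[of z' j] j by (simp add: z'_def)
    ultimately have "degree (scaling_poly e h z') \<ge> D" using de[of j] j(2) by (metis mult_le_mono1)
    then have deg: "degree (scaling_poly e h z') = D" using degree_le[of z'] by simp
    then have "lead_coeff (scaling_poly e h z') \<noteq> 0" using D by auto
    then show False using Hz' deg by (simp add: coeff_scaling_poly)
  qed
  have "weighted_definite e d D h"
    unfolding weighted_definite_def using D de ev wt pd by blast
  then show ?thesis by blast
qed

text \<open>Whatever the function \<open>deg\<close>, a basis for which the sum of its values is least is adapted:
  otherwise exchanging one basis vector for \<open>A *v y\<close> would decrease the sum.\<close>
lemma adapted_basis:
  fixes deg :: "real ^ 'n::finite \<Rightarrow> nat"
  shows "\<exists>A :: real ^ 'n ^ 'n. invertible A \<and> (\<forall>y i. y $ i \<noteq> 0 \<longrightarrow> deg (A *v axis i 1) \<le> deg (A *v y))"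
proof -
  define Q where "Q A \<longleftrightarrow> det (A :: real ^ 'n ^ 'n) \<noteq> 0" for A
  define m where "m A = (\<Sum>i\<in>UNIV. deg (column i A))" for A :: "real ^ 'n ^ 'n"
  have "Q (mat 1)" by (simp add: Q_def)
  then obtain A where A: "Q A" "\<And>A'. Q A' \<Longrightarrow> m A \<le> m A'"
    using ex_has_least_nat[of Q "mat 1" m] by blast
  have "deg (A *v axis i 1) \<le> deg (A *v y)" if y: "y $ i \<noteq> 0" for y i
  proof -
    define A' where "A' = ((\<chi> k j. if j = i then (A *v y) $ k else A $ k $ j) :: real ^ 'n ^ 'n)"
    have "det A' = y $ i * det A" unfolding A'_def by (rule cramer_lemma)
    then have "m A \<le> m A'" using A y by (simp add: Q_def)
    moreover have "column j A' = (if j = i then A *v y else column j A)" for j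
      by (simp add: A'_def column_def vec_eq_iff)
    ultimately have "deg (column i A) \<le> deg (A *v y)"
      by (simp add: m_def sum.remove[of UNIV i])
    then show ?thesis by (simp add: matrix_vector_mul_component column_def matrix_vector_mult_basis)
  qed
  moreover have "invertible A" using A(1) by (simp add: Q_def invertible_det_nz)
  ultimately show ?thesis by blast
qed

section \<open>Certificates for positivity on the sublevel sets of a convex polynomial\<close>

lemma sublevel_bounded:
  fixes h :: "'n::finite mpoly"
  assumes conv: "convex_on UNIV (mp_eval h)" and lower: "\<And>x. B \<le> mp_eval h x"
    and nonconst: "\<And>u. u \<noteq> 0 \<Longrightarrow> \<exists>t. mp_eval h (t *\<^sub>R u) \<noteq> mp_eval h 0"
  shows "bounded {x. mp_eval h x \<le> c}"
proof (rule ccontr)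
  assume unb: "\<not> bounded {x. mp_eval h x \<le> c}"
  then have "\<exists>x. mp_eval h x \<le> c \<and> norm x > real k" for k :: nat
    unfolding bounded_iff by (auto simp: not_le)
  then obtain w where w: "\<And>k. mp_eval h (w k) \<le> c" "\<And>k. norm (w k) > real k" by metis
  have "\<not> bounded (range w)"
  proof
    assume "bounded (range w)"
    then obtain b where "\<And>k. norm (w k) \<le> b" by (auto simp: bounded_iff)
    moreover obtain k where "real k > b" using reals_Archimedean2 by blast
    ultimately show False using w(2)[of k] by (meson less_trans not_le)
  qed
  then obtain s u where su: "filterlim (\<lambda>k. norm (w (s k))) at_top sequentially"
    "(\<lambda>k. w (s k) /\<^sub>R norm (w (s k))) \<longlonglongrightarrow> u" "norm u = 1"
    by (rule escaping_direction)
  have rec: "mp_eval h (0 + t *\<^sub>R u) \<le> mp_eval h 0" if "t \<ge> 0" for t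
    by (rule convex_recession_seq[OF conv continuous_mp_eval su(1,2) w(1) that])
  have "\<bar>mp_eval h (0 + t *\<^sub>R u)\<bar> \<le> \<bar>B\<bar> + \<bar>mp_eval h 0\<bar>" if "t \<ge> 0" for t
    using rec[OF that] lower[of "0 + t *\<^sub>R u"] by linarith
  then have "mp_eval h (0 + t *\<^sub>R u) = mp_eval h 0" for t
    by (rule mp_const_on_bounded_ray[OF conv])
  moreover have "u \<noteq> 0" using su(3) by auto
  ultimately show False using nonconst[of u] by simp
qed

lemma mp_eval_sq_norm_poly: "mp_eval sq_norm_poly x = (norm x)\<^sup>2"
  by (simp add: sq_norm_poly_def norm_vec_def L2_set_def sum_nonneg)

lemma gen_preordering_pull:
  assumes "linear A" "p \<in> gen_preordering g"
  shows "mp_pull A p \<in> gen_preordering (mp_pull A g)"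
proof -
  obtain s t where st: "s \<in> SOS" "t \<in> SOS" "p = s + t * g"
    using assms(2) unfolding gen_preordering_def by (rule adjoinE)
  have "mp_pull A p = mp_pull A s + mp_pull A t * mp_pull A g"
    by (rule mp_eqI) (simp add: mp_eval_pull[OF assms(1)] st(3))
  then show ?thesis
    unfolding gen_preordering_def using st SOS_pull[OF assms(1)] by (metis adjoinI)
qed

lemma line_degree_pos:
  assumes "\<exists>t. mp_eval h (t *\<^sub>R u) \<noteq> mp_eval h 0"
  shows "line_degree h u > 0"
proof (rule ccontr)
  assume "\<not> line_degree h u > 0"
  then obtain c where "line_poly h u = [:c:]" unfolding line_degree_def by (metis degree_eq_zeroE neq0_conv)
  then have "mp_eval h (t *\<^sub>R u) = c" for t using poly_line_poly[of h u t] by simp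
  from this this[of 0] show False using assms by simp
qed

text \<open>An analogue of Schmuedgen's theorem for a sublevel set of a convex polynomial that is bounded below
  and constant on no line through the origin.\<close>
theorem convex_sublevel_certificate:
  fixes h p :: "'n::finite mpoly"
  assumes conv: "convex_on UNIV (mp_eval h)" and lower: "\<And>x. B \<le> mp_eval h x"
    and nonconst: "\<And>u. u \<noteq> 0 \<Longrightarrow> \<exists>t. mp_eval h (t *\<^sub>R u) \<noteq> mp_eval h 0"
    and pos: "\<And>x. mp_eval h x \<le> c \<Longrightarrow> mp_eval p x > 0"
  shows "p \<in> gen_preordering (mp_const c - h)"
proof -
  obtain A :: "real ^ 'n ^ 'n" where A: "invertible A"
    "\<And>y i. y $ i \<noteq> 0 \<Longrightarrow> line_degree h (A *v axis i 1) \<le> line_degree h (A *v y)"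
    using adapted_basis[of "line_degree h"] by blast
  obtain A' where A': "A ** A' = mat 1" "A' ** A = mat 1" using A(1) by (auto simp: invertible_def)
  have AA': "A *v (A' *v x) = x" and A'A: "A' *v (A *v x) = x" for x
    by (simp_all add: matrix_vector_mul_assoc A')
  note lin = matrix_vector_mul_linear[of A] matrix_vector_mul_linear[of A']
  let ?h = "mp_pull ((*v) A) h" and ?p = "mp_pull ((*v) A) p"
  have evh: "mp_eval ?h x = mp_eval h (A *v x)" for x by (rule mp_eval_pull[OF lin(1)])
  have evp: "mp_eval ?p x = mp_eval p (A *v x)" for x by (rule mp_eval_pull[OF lin(1)])
  have deg: "line_degree ?h y = line_degree h (A *v y)" for y
    unfolding line_degree_def
    by (rule arg_cong[of _ _ degree], rule line_poly_unique)
       (simp add: evh poly_line_poly matrix_vector_mult_scaleR)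
  have conv': "convex_on UNIV (mp_eval ?h)"
    unfolding convex_on_def using conv
    by (auto simp: evh matrix_vector_right_distrib matrix_vector_mult_scaleR convex_on_def)
  have nonconst': "\<exists>t. mp_eval ?h (t *\<^sub>R u) \<noteq> mp_eval ?h 0" if "u \<noteq> 0" for u
  proof -
    have "A *v u \<noteq> 0" using that A'A[of u] by auto
    then show ?thesis using nonconst[of "A *v u"] by (simp add: evh matrix_vector_mult_scaleR)
  qed
  have "\<exists>e d D. weighted_definite e d D ?h"
  proof (rule weighted_definite_of_adapted[OF conv'])
    show "B \<le> mp_eval ?h x" for x by (simp add: evh lower)
    show "line_degree ?h (axis i 1) > 0" for i
      by (rule line_degree_pos, rule nonconst') (simp add: axis_eq_0_iff)
    show "line_degree ?h (axis i 1) \<le> line_degree ?h y" if "y $ i \<noteq> 0" for y i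
      unfolding deg by (rule A(2)[OF that])
  qed
  then obtain e d D where wd: "weighted_definite e d D ?h" by blast
  have "bounded {x. mp_eval ?h x \<le> c}"
    by (rule sublevel_bounded[OF conv' _ nonconst', of B]) (simp_all add: evh lower)
  then obtain b where b: "\<And>x. mp_eval ?h x \<le> c \<Longrightarrow> norm x \<le> b" by (auto simp: bounded_iff)
  have "?p \<in> gen_preordering (mp_const c - ?h)"
  proof (rule positive_on_orderings_imp_mem[OF preordering_gen, of "b\<^sup>2 + 1"])
    fix P :: "'n mpoly set"
    assume P: "ring_ordering P" "gen_preordering (mp_const c - ?h) \<subseteq> P"
    then have c: "mp_const c - ?h \<in> P" using gen_preordering_self by blast
    show "- (mp_const (b\<^sup>2 + 1) - sq_norm_poly) \<notin> P"
    proof (rule weighted_definite_positive[OF wd P(1) c])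
      fix x assume "mp_eval ?h x \<le> c"
      then have "(norm x)\<^sup>2 \<le> b\<^sup>2" by (intro power_mono b) auto
      then show "mp_eval (mp_const (b\<^sup>2 + 1) - sq_norm_poly) x > 0" by (simp add: mp_eval_sq_norm_poly)
    qed
    show "- ?p \<notin> P"
      by (rule weighted_definite_positive[OF wd P(1) c]) (simp add: evh evp pos)
  qed simp
  then have "mp_pull ((*v) A') ?p \<in> gen_preordering (mp_pull ((*v) A') (mp_const c - ?h))"
    by (rule gen_preordering_pull[OF lin(2)])
  moreover have "mp_pull ((*v) A') ?p = p"
    by (rule mp_eqI) (simp add: mp_eval_pull[OF lin(2)] evp AA')
  moreover have "mp_pull ((*v) A') (mp_const c - ?h) = mp_const c - h"
    by (rule mp_eqI) (simp add: mp_eval_pull[OF lin(2)] evh AA')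
  ultimately show ?thesis by simp
qed

section \<open>Convex polynomials that are bounded below\<close>

lemma convex_on_inner_square: "convex_on UNIV (\<lambda>x::'a::real_inner. (v \<bullet> x)\<^sup>2)"
  unfolding convex_on_def
proof (intro conjI ballI allI impI)
  fix x y :: 'a and s t :: real
  assume st: "s \<ge> 0" "t \<ge> 0" "s + t = 1"
  let ?a = "v \<bullet> x" and ?b = "v \<bullet> y"
  have t: "t = 1 - s" using st by simp
  have "s * ?a\<^sup>2 + t * ?b\<^sup>2 - (s * ?a + t * ?b)\<^sup>2 = s * t * (?a - ?b)\<^sup>2"
    unfolding t by (simp add: power2_eq_square algebra_simps)
  moreover have "s * t * (?a - ?b)\<^sup>2 \<ge> 0" using st by simp
  ultimately show "(v \<bullet> (s *\<^sub>R x + t *\<^sub>R y))\<^sup>2 \<le> s * ?a\<^sup>2 + t * ?b\<^sup>2"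
    by (simp add: inner_add_right)
qed simp

lemma convex_on_sum_fun:
  fixes F :: "'i \<Rightarrow> 'a::real_vector \<Rightarrow> real"
  assumes "\<And>i. i \<in> I \<Longrightarrow> convex_on UNIV (F i)"
  shows "convex_on UNIV (\<lambda>x. \<Sum>i\<in>I. F i x)"
  using assms by (induction I rule: infinite_finite_induct) (auto simp: convex_on_const intro!: convex_on_add)

text \<open>The linear form given by the inner product with \<open>v\<close>.\<close>
definition inner_poly :: "real ^ 'n::finite \<Rightarrow> 'n mpoly" where
  "inner_poly v = (\<Sum>i\<in>UNIV. mp_const (v $ i) * mp_var i)"

lemma mp_eval_inner_poly: "mp_eval (inner_poly v) x = v \<bullet> x"
  by (simp add: inner_poly_def inner_vec_def)

text \<open>The squares of the coordinates on the space \<open>V\<close> of directions along which \<open>L\<close> is constant are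
  added to \<open>L\<close>, and afterwards removed by pulling the certificate back along the orthogonal projection
  with kernel \<open>V\<close>.\<close>
theorem bounded_below_convex_certificate:
  fixes L :: "'n::finite mpoly"
  assumes conv: "convex_on UNIV (mp_eval L)" and pos: "\<And>x. mp_eval L x + a > 0"
  shows "L + mp_const a \<in> gen_preordering (mp_const c - L)"
proof -
  define V where "V = {u. \<forall>x t. mp_eval L (x + t *\<^sub>R u) = mp_eval L x}"
  have VI: "u \<in> V" if "\<And>t. mp_eval L (t *\<^sub>R u) \<le> M" for u M
    using convex_const_direction[OF conv continuous_mp_eval, of 0 u M] that by (auto simp: V_def)
  have "subspace V"
  proof (rule subspaceI)
    fix u v assume uv: "u \<in> V" "v \<in> V"
    have "mp_eval L (x + t *\<^sub>R (u + v)) = mp_eval L x" for x t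
    proof -
      have "mp_eval L (x + t *\<^sub>R (u + v)) = mp_eval L ((x + t *\<^sub>R u) + t *\<^sub>R v)"
        by (simp add: algebra_simps)
      then show ?thesis using uv by (simp add: V_def)
    qed
    then show "u + v \<in> V" by (simp add: V_def)
  next
    fix r u assume "u \<in> V"
    then have "mp_eval L (x + (t * r) *\<^sub>R u) = mp_eval L x" for x t by (simp add: V_def)
    then show "r *\<^sub>R u \<in> V" by (simp add: V_def)
  qed (simp add: V_def)
  then obtain W where W: "W \<subseteq> V" "pairwise orthogonal W" "\<And>v. v \<in> W \<Longrightarrow> norm v = 1"
    "independent W" "span W = V"
    by (metis orthonormal_basis_subspace)
  then have finW: "finite W" by (simp add: independent_imp_finite)
  define h where "h = L + (\<Sum>v\<in>W. (inner_poly v)\<^sup>2)"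
  have evh: "mp_eval h x = mp_eval L x + (\<Sum>v\<in>W. (v \<bullet> x)\<^sup>2)" for x
    by (simp add: h_def mp_eval_inner_poly)
  have Lh: "mp_eval L x \<le> mp_eval h x" for x
    unfolding evh using sum_nonneg[of W "\<lambda>v. (v \<bullet> x)\<^sup>2"] by simp
  have "mp_eval h = (\<lambda>x. mp_eval L x + (\<Sum>v\<in>W. (v \<bullet> x)\<^sup>2))" by (rule ext) (rule evh)
  then have convh: "convex_on UNIV (mp_eval h)"
    by (simp add: convex_on_add conv convex_on_sum_fun convex_on_inner_square)
  have cert: "L + mp_const a \<in> gen_preordering (mp_const c - h)"
  proof (rule convex_sublevel_certificate[OF convh])
    show "- a \<le> mp_eval h x" for x using pos[of x] Lh[of x] by linarith
    show "mp_eval (L + mp_const a) x > 0" for x using pos[of x] by simp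
    fix u :: "real ^ 'n" assume u: "u \<noteq> 0"
    show "\<exists>t. mp_eval h (t *\<^sub>R u) \<noteq> mp_eval h 0"
    proof (rule ccontr)
      assume "\<not> (\<exists>t. mp_eval h (t *\<^sub>R u) \<noteq> mp_eval h 0)"
      then have const: "mp_eval h (t *\<^sub>R u) = mp_eval h 0" for t by blast
      have "mp_eval L (t *\<^sub>R u) \<le> mp_eval h 0" for t using Lh[of "t *\<^sub>R u"] const[of t] by simp
      then have uV: "u \<in> V" by (rule VI)
      then have "mp_eval L (0 + 1 *\<^sub>R u) = mp_eval L 0" unfolding V_def by blast
      then have "(\<Sum>v\<in>W. (v \<bullet> u)\<^sup>2) = 0" using const[of 1] by (simp add: evh)
      then have "\<forall>v\<in>W. v \<bullet> u = 0" using finW by (simp add: sum_nonneg_eq_0_iff)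
      then have "orthogonal u v" if "v \<in> W" for v
        using that by (auto simp: orthogonal_def inner_commute)
      then have "orthogonal u u" using uV W(5) by (metis orthogonal_to_span)
      then show False using u by (simp add: orthogonal_def)
    qed
  qed
  define A where "A x = x - (\<Sum>v\<in>W. (v \<bullet> x) *\<^sub>R v)" for x
  have linA: "linear A"
    unfolding A_def
    by (intro linearI) (simp_all add: inner_add_right scaleR_add_left sum.distrib scaleR_sum_right algebra_simps)
  have LA: "mp_eval L (A x) = mp_eval L x" for x
  proof -
    have "- (\<Sum>v\<in>W. (v \<bullet> x) *\<^sub>R v) \<in> V"
      using \<open>subspace V\<close> W(1) by (intro subspace_neg subspace_sum subspace_scale) auto
    then have "mp_eval L (x + 1 *\<^sub>R (- (\<Sum>v\<in>W. (v \<bullet> x) *\<^sub>R v))) = mp_eval L x"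
      unfolding V_def by blast
    then show ?thesis by (simp add: A_def)
  qed
  have WA: "v \<bullet> A x = 0" if v: "v \<in> W" for v x
  proof -
    have "v \<bullet> (\<Sum>w\<in>W. (w \<bullet> x) *\<^sub>R w) = (\<Sum>w\<in>W. if w = v then v \<bullet> x else 0)"
      unfolding inner_sum_right
    proof (rule sum.cong[OF refl])
      fix w assume w: "w \<in> W"
      show "v \<bullet> ((w \<bullet> x) *\<^sub>R w) = (if w = v then v \<bullet> x else 0)"
        using W(2) W(3)[OF v] v w by (auto simp: pairwise_def orthogonal_def dot_square_norm)
    qed
    then show ?thesis using finW v by (simp add: A_def inner_diff_right)
  qed
  have "mp_pull A (L + mp_const a) \<in> gen_preordering (mp_pull A (mp_const c - h))"
    by (rule gen_preordering_pull[OF linA cert])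
  moreover have "mp_pull A (L + mp_const a) = L + mp_const a"
    by (rule mp_eqI) (simp add: mp_eval_pull[OF linA] LA)
  moreover have "mp_pull A (mp_const c - h) = mp_const c - L"
    by (rule mp_eqI) (simp add: mp_eval_pull[OF linA] evh LA WA)
  ultimately show ?thesis by simp
qed

section \<open>Convergence of the hierarchy\<close>

lemma trunc_qmodule_nonneg:
  assumes "p \<in> trunc_qmodule c f m g k" "x \<in> feasible_set m g" "mp_eval f x \<le> c"
  shows "mp_eval p x \<ge> 0"
proof -
  obtain \<sigma> \<sigma>0 \<sigma>s where p: "p = \<sigma>0 - (\<Sum>i=1..m. \<sigma>s i * g i) + \<sigma> * (mp_const c - f)"
    and sos: "\<sigma> \<in> SOS" "\<sigma>0 \<in> SOS" "\<And>i. i \<in> {1..m} \<Longrightarrow> \<sigma>s i \<in> SOS"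
    using assms(1) unfolding trunc_qmodule_def by blast
  have "(\<Sum>i=1..m. mp_eval (\<sigma>s i) x * mp_eval (g i) x) \<le> 0"
    using assms(2) sos(3) by (intro sum_nonpos mult_nonneg_nonpos SOS_eval_nonneg) (auto simp: feasible_set_def)
  moreover have "mp_eval \<sigma> x * (c - mp_eval f x) \<ge> 0"
    using assms(3) sos(1) by (intro mult_nonneg_nonneg SOS_eval_nonneg) auto
  ultimately show ?thesis using SOS_eval_nonneg[OF sos(2), of x] by (simp add: p)
qed

text \<open>Every feasible point with \<open>f x \<le> c\<close>, in particular a minimizer, bounds all relaxations from above.\<close>
lemma sos_bound_le:
  assumes "x \<in> feasible_set m g" "mp_eval f x \<le> c"
  shows "sos_bound c f m g k \<le> ereal (mp_eval f x)"
  unfolding sos_bound_def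
proof (rule Sup_least)
  fix y assume "y \<in> ereal ` {\<mu>. f - mp_const \<mu> \<in> trunc_qmodule c f m g k}"
  then obtain \<mu> where "y = ereal \<mu>" "f - mp_const \<mu> \<in> trunc_qmodule c f m g k" by blast
  then show "y \<le> ereal (mp_eval f x)" using trunc_qmodule_nonneg[OF _ assms] by fastforce
qed

lemma qmodule_certificate_eventually:
  fixes f :: "'n::finite mpoly"
  assumes eq: "f - mp_const \<mu> = \<sigma>0 - (\<Sum>i=1..m. \<sigma>s i * g i) + \<sigma> * (mp_const c - f)"
    and sos: "\<sigma> \<in> SOS" "\<sigma>0 \<in> SOS" "\<And>i. i \<in> {1..m} \<Longrightarrow> \<sigma>s i \<in> SOS"
  shows "\<forall>\<^sub>F k in at_top. ereal \<mu> \<le> sos_bound c f m g k"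
proof -
  define K where "K = mp_degree \<sigma>0 + mp_degree (\<sigma> * (mp_const c - f)) + (\<Sum>i=1..m. mp_degree (\<sigma>s i * g i))"
  have "ereal \<mu> \<le> sos_bound c f m g k" if k: "k \<ge> int K" for k
  proof -
    have deg: "deg_le p (2 * k)" if "mp_degree p \<le> K" for p :: "'n mpoly"
      using that k by (simp add: deg_le_def)
    have "mp_degree (\<sigma>s i * g i) \<le> K" if "i \<in> {1..m}" for i
    proof -
      have "mp_degree (\<sigma>s i * g i) \<le> (\<Sum>i=1..m. mp_degree (\<sigma>s i * g i))"
        using that by (intro member_le_sum) auto
      then show ?thesis by (simp add: K_def)
    qed
    then have "\<forall>i\<in>{1..m}. deg_le (\<sigma>s i * g i) (2 * k)" using deg by blast
    moreover have "deg_le \<sigma>0 (2 * k)" "deg_le (\<sigma> * (mp_const c - f)) (2 * k)"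
      by (rule deg, simp add: K_def)+
    ultimately have "f - mp_const \<mu> \<in> trunc_qmodule c f m g k"
      unfolding trunc_qmodule_def mem_Collect_eq using eq sos by (intro exI conjI) auto
    then show ?thesis unfolding sos_bound_def by (intro Sup_upper) blast
  qed
  then show ?thesis unfolding eventually_at_top_linorder by blast
qed

text \<open>With the Lagrangian \<open>L = f + (\<Sum>i. l i * g i)\<close>, a certificate \<open>s + t * (c - L)\<close> of
  \<open>L - (v - \<epsilon>)\<close> becomes one of \<open>f - (v - \<epsilon>)\<close> in which the constraint \<open>g i\<close> has the multiplier
  \<open>l i * (1 + t)\<close>.\<close>
lemma lagrangian_certificate:
  fixes f :: "'n::finite mpoly" and g :: "nat \<Rightarrow> 'n mpoly"
  assumes convf: "convex_on UNIV (mp_eval f)"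
    and convg: "\<And>i. i \<in> {1..m} \<Longrightarrow> convex_on UNIV (mp_eval (g i))"
    and x0: "x0 \<in> feasible_set m g"
    and v: "\<And>x. x \<in> feasible_set m g \<Longrightarrow> v \<le> mp_eval f x" and e: "\<epsilon> > 0"
  obtains \<sigma> \<sigma>0 \<sigma>s where "\<sigma> \<in> SOS" "\<sigma>0 \<in> SOS" "\<And>i. i \<in> {1..m} \<Longrightarrow> \<sigma>s i \<in> SOS"
    "f - mp_const (v - \<epsilon>) = \<sigma>0 - (\<Sum>i=1..m. \<sigma>s i * g i) + \<sigma> * (mp_const c - f)"
proof -
  have "\<exists>l. (\<forall>i\<in>{1..m}. l i \<ge> 0) \<and> (\<forall>x. v - \<epsilon> / 2 \<le> mp_eval f x + (\<Sum>i=1..m. l i * mp_eval (g i) x))"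
    by (rule convex_polynomial_zero_duality_gap[OF _ convg convf, where ?x0.0 = x0])
       (use x0 v e in \<open>auto simp: feasible_set_def\<close>)
  then obtain l where l: "\<And>i. i \<in> {1..m} \<Longrightarrow> l i \<ge> 0"
    "\<And>x. v - \<epsilon> / 2 \<le> mp_eval f x + (\<Sum>i=1..m. l i * mp_eval (g i) x)" by blast
  define L where "L = f + (\<Sum>i=1..m. mp_const (l i) * g i)"
  have evL: "mp_eval L x = mp_eval f x + (\<Sum>i=1..m. l i * mp_eval (g i) x)" for x
    by (simp add: L_def)
  have "mp_eval L = (\<lambda>x. mp_eval f x + (\<Sum>i=1..m. l i * mp_eval (g i) x))" by (rule ext) (rule evL)
  moreover have "convex_on UNIV (\<lambda>x. mp_eval f x + (\<Sum>i=1..m. l i * mp_eval (g i) x))"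
    using l(1) by (intro convex_on_add convf convex_on_sum_fun convex_on_cmul convg)
  ultimately have "convex_on UNIV (mp_eval L)" by simp
  moreover have "mp_eval L x + (\<epsilon> - v) > 0" for x using l(2)[of x] e by (simp add: evL)
  ultimately have "L + mp_const (\<epsilon> - v) \<in> gen_preordering (mp_const c - L)"
    by (rule bounded_below_convex_certificate)
  then obtain s t where st: "s \<in> SOS" "t \<in> SOS" "L + mp_const (\<epsilon> - v) = s + t * (mp_const c - L)"
    unfolding gen_preordering_def by (rule adjoinE)
  show ?thesis
  proof (rule that[of t s "\<lambda>i. mp_const (l i) * (1 + t)"])
    show "mp_const (l i) * (1 + t) \<in> SOS" if "i \<in> {1..m}" for i
      using st(2) l(1)[OF that] by (simp add: SOS_const)
    let ?G = "\<Sum>i=1..m. mp_const (l i) * g i"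
    have "(\<Sum>i=1..m. (mp_const (l i) * (1 + t)) * g i) = (1 + t) * ?G"
      by (simp add: sum_distrib_left mult_ac)
    moreover have "f - mp_const (v - \<epsilon>) = (L + mp_const (\<epsilon> - v)) - ?G"
      by (simp add: L_def mp_const_diff)
    moreover have "\<dots> = s - (1 + t) * ?G + t * (mp_const c - f)"
      unfolding st(3) by (simp add: L_def algebra_simps)
    ultimately show "f - mp_const (v - \<epsilon>) =
        s - (\<Sum>i=1..m. (mp_const (l i) * (1 + t)) * g i) + t * (mp_const c - f)" by simp
  qed (use st in auto)
qed

theorem theorem2p1:
  fixes f :: "'n::finite mpoly"
    and g :: "nat \<Rightarrow> 'n mpoly"
    and m :: nat
    and xs :: "real ^ 'n"
    and fs c :: real
  assumes "convex_on UNIV (mp_eval f)"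
    and "\<And>i. i \<in> {1..m} \<Longrightarrow> convex_on UNIV (mp_eval (g i))"
    and "feasible_set m g \<noteq> {}"
    and "is_arg_min (mp_eval f) (\<lambda>x. x \<in> feasible_set m g) xs"
    and "fs = mp_eval f xs"
    and "\<exists>x0\<in>feasible_set m g. mp_eval f x0 < c"
  shows "((\<lambda>k::int. sos_bound c f m g k) \<longlongrightarrow> ereal fs) at_top"
proof -
  have xs: "xs \<in> feasible_set m g" and min: "\<And>x. x \<in> feasible_set m g \<Longrightarrow> fs \<le> mp_eval f x"
    using assms(4,5) by (auto simp: is_arg_min_def not_less)
  have upper: "sos_bound c f m g k \<le> ereal fs" for k
    using sos_bound_le[OF xs] min assms(5,6) by force
  show ?thesis
  proof (rule order_tendstoI)
    fix a assume "a < ereal fs"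
    then obtain \<mu> where \<mu>: "a < ereal \<mu>" "\<mu> < fs" using ereal_dense2 by force
    obtain \<sigma> \<sigma>0 \<sigma>s where "\<sigma> \<in> SOS" "\<sigma>0 \<in> SOS" "\<And>i. i \<in> {1..m} \<Longrightarrow> \<sigma>s i \<in> SOS"
      "f - mp_const (fs - (fs - \<mu>)) = \<sigma>0 - (\<Sum>i=1..m. \<sigma>s i * g i) + \<sigma> * (mp_const c - f)"
      by (rule lagrangian_certificate[OF assms(1,2) xs min, of "fs - \<mu>" c]) (use \<mu>(2) in auto)
    then have "\<forall>\<^sub>F k in at_top. ereal \<mu> \<le> sos_bound c f m g k"
      by (intro qmodule_certificate_eventually[of f \<mu> \<sigma>0 \<sigma>s g m \<sigma> c]) auto
    then show "\<forall>\<^sub>F k in at_top. a < sos_bound c f m g k"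
      by eventually_elim (rule less_le_trans[OF \<mu>(1)])
  next
    fix a assume "ereal fs < a"
    then show "\<forall>\<^sub>F k in at_top. sos_bound c f m g k < a"
      using upper by (intro always_eventually) (auto intro: le_less_trans)
  qed
qed

end
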